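(* Let $g\in C^2(\mathbb{R}^n)$ and $u(x,t)=\min_{|x-y|\le t}g(y)$. Then the set of singularity points $\Sigma\cup T_1$ is composed of at most countably many path connected components; that is, $\Sigma\cup T_1=\bigcup_i T(F_i)=\bigcup_j S_j$, where the $S_j$ (at most countably many) are the path connected components of $\Sigma\cup T_1$.
   Context: $|\cdot|$ is the Euclidean norm. $u$ is the Hopf–Lax solution of $u_t+|\nabla u|=0$ with $u(\cdot,0)=g$. A point $y$ is a minimizer for $(x,t)$ if $|y-x|\le t$ and $u(x,t)=g(y)$. For $y_0$ with $Dg(y_0)\ne0$ put $X(y_0,t)=y_0+\frac{Dg(y_0)}{|Dg(y_0)|}t$ and define, in $[0,\infty]$, $\overline t_s(y_0)=\sup\{t>0 : y_0$ is the unique minimizer for $(X(y_0,t),t)\}$ and $t_s(y_0)=\inf\{t>0 : y_0$ is not a minimizer for $(X(y_0,t),t)\}$ (with $\sup\emptyset=0$, $\inf\emptyset=\infty$); one has $\overline t_s\le t_s$. $M=\{y_0 : Dg(y_0)\neq0,\ \overline t_s(y_0)<\infty\}$. For $S\subset M$, $T(S)$ is the set of points $(X(y_0,t),t)$ with $y_0\in S$ and $t\in[\overline t_s(y_0),t_s(y_0)]$ if $t_s(y_0)<\infty$, $t\in[\overline t_s(y_0),\infty)$ if $t_s(y_0)=\infty$. $\Sigma\subset\mathbb{R}^n\times\{t>0\}$ is the set of points where $u$ is not differentiable. $T_1$ is the set of points of $T(M)$ that have a unique minimizer. $H_{y_0}=\{y : (y-y_0)\cdot Dg(y_0)>0\}$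 and $E=\{y_0 : Dg(y_0)\ne0,\ \exists\,\bar y\in H_{y_0}$ with $g(\bar y)<g(y_0)\}$. The $E_i$ are the path connected components of $E$. For $y_0$ with $Dg(y_0)\neq 0$, $H^+(y_0)$ is the set of points $y$ in a small neighborhood of $y_0$ (on which the level set $\{g=g(y_0)\}$ is a hypersurface separating the neighborhood) with $g(y)>g(y_0)$. $F_i$ is the union of $E_i$ with all $y_0\in M\setminus E$ for which there is a neighborhood $U$ of $y_0$ with $U\cap H^+(y_0)\subset E_i$. *)

theory Defs
  imports "HOL-Analysis.Analysis"
begin

definition grad :: "(real ^ 'n \<Rightarrow> real) \<Rightarrow> real ^ 'n \<Rightarrow> real ^ 'n" where
  "grad g y = (THE D. GDERIV g y :> D)"

lemma GDERIV_grad: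
  fixes g :: "real ^ 'n \<Rightarrow> real"
  assumes "g differentiable (at y)"
  shows "GDERIV g y :> grad g y"
proof -
  obtain g' where g': "(g has_derivative g') (at y)"
    using assms by (auto simp: differentiable_def)
  then interpret g': bounded_linear g'
    by (rule has_derivative_bounded_linear)
  have "g' = (\<lambda>h. inner h (adjoint g' 1))"
  proof
    fix h show "g' h = inner h (adjoint g' 1)"
      using adjoint_works[OF g'.linear, of h 1] by simp
  qed
  with g' have 1: "GDERIV g y :> adjoint g' 1"
    by (simp add: gderiv_def)
  have 2: "D = adjoint g' 1" if "GDERIV g y :> D" for D
  proof -
    have "(\<lambda>h. inner h D) = (\<lambda>h. inner h (adjoint g' 1))"
      using that 1 has_derivative_unique unfolding gderiv_def by blast
    then show ?thesis
      by (simp only: fun_eq_iff vector_eq_ldot)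
  qed
  show ?thesis
    unfolding grad_def by (rule theI[where P = "\<lambda>D. GDERIV g y :> D", OF 1 2])
qed

text \<open>Twice continuously differentiable on the whole space; \<open>H y\<close> is the Hessian as a bounded
  linear map, and \<open>H\<close> is continuous in the operator norm.\<close>

definition C2 :: "(real ^ 'n \<Rightarrow> real) \<Rightarrow> bool" where
  "C2 g \<longleftrightarrow> (\<forall>y. g differentiable (at y)) \<and>
     (\<exists>H :: real ^ 'n \<Rightarrow> (real ^ 'n) \<Rightarrow>\<^sub>L (real ^ 'n).
        continuous_on UNIV H \<and> (\<forall>y. (grad g has_derivative blinfun_apply (H y)) (at y)))"

text \<open>The Hopf--Lax solution. For continuous \<open>g\<close> and \<open>t \<ge> 0\<close> the infimum is a minimum, see
  \<open>hopf_lax_min\<close>; the value for \<open>t < 0\<close> is junk and is never used.\<close>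

definition hopf_lax :: "(real ^ 'n \<Rightarrow> real) \<Rightarrow> real ^ 'n \<Rightarrow> real \<Rightarrow> real" where
  "hopf_lax g x t = (INF y \<in> {y. norm (x - y) \<le> t}. g y)"

lemma hopf_lax_min:
  fixes g :: "real ^ 'n \<Rightarrow> real"
  assumes "continuous_on UNIV g" and "0 \<le> t"
  shows "\<exists>y. norm (x - y) \<le> t \<and> hopf_lax g x t = g y \<and> (\<forall>z. norm (x - z) \<le> t \<longrightarrow> g y \<le> g z)"
proof -
  have eq: "{y. norm (x - y) \<le> t} = cball x t"
    by (auto simp: dist_norm)
  have "cball x t \<noteq> {}" and "continuous_on (cball x t) g"
    using assms continuous_on_subset[OF assms(1) subset_UNIV] by simp_all
  then obtain y where y: "y \<in> cball x t" "\<forall>z \<in> cball x t. g y \<le> g z"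
    using continuous_attains_inf[OF compact_cball] by blast
  have "hopf_lax g x t = g y"
    unfolding hopf_lax_def eq using y by (intro cInf_eq_minimum) auto
  with y show ?thesis
    by (auto simp: dist_norm)
qed

definition minimizer :: "(real ^ 'n \<Rightarrow> real) \<Rightarrow> real ^ 'n \<Rightarrow> real \<Rightarrow> real ^ 'n \<Rightarrow> bool" where
  "minimizer g x t y \<longleftrightarrow> norm (y - x) \<le> t \<and> hopf_lax g x t = g y"

definition unique_minimizer :: "(real ^ 'n \<Rightarrow> real) \<Rightarrow> real ^ 'n \<Rightarrow> real \<Rightarrow> real ^ 'n \<Rightarrow> bool" where
  "unique_minimizer g x t y \<longleftrightarrow> minimizer g x t y \<and> (\<forall>z. minimizer g x t z \<longrightarrow> z = y)"

definition char_pt :: "(real ^ 'n \<Rightarrow> real) \<Rightarrow> real ^ 'n \<Rightarrow> real \<Rightarrow> real ^ 'n" where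
  "char_pt g y t = y + t *\<^sub>R (grad g y /\<^sub>R norm (grad g y))"

text \<open>The two times take values in \<open>[0,\<infinity>]\<close>, where \<open>Sup {} = 0\<close> and \<open>Inf {} = \<infinity>\<close>.\<close>

definition tbar_s :: "(real ^ 'n \<Rightarrow> real) \<Rightarrow> real ^ 'n \<Rightarrow> ennreal" where
  "tbar_s g y = Sup {ennreal t |t. 0 < t \<and> unique_minimizer g (char_pt g y t) t y}"

definition t_s :: "(real ^ 'n \<Rightarrow> real) \<Rightarrow> real ^ 'n \<Rightarrow> ennreal" where
  "t_s g y = Inf {ennreal t |t. 0 < t \<and> \<not> minimizer g (char_pt g y t) t y}"

definition M_set :: "(real ^ 'n \<Rightarrow> real) \<Rightarrow> (real ^ 'n) set" where
  "M_set g = {y. grad g y \<noteq> 0 \<and> tbar_s g y < \<infinity>}"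

text \<open>When \<open>t_s g y = \<infinity>\<close> the upper bound on the real number \<open>t\<close> is vacuous, so both cases of
  the definition of \<open>T(S)\<close> are covered. The condition \<open>0 \<le> t\<close> is needed because
  \<^const>\<open>ennreal\<close> sends negative numbers to \<open>0\<close>.\<close>

definition T_set :: "(real ^ 'n \<Rightarrow> real) \<Rightarrow> (real ^ 'n) set \<Rightarrow> ((real ^ 'n) \<times> real) set" where
  "T_set g S = {(char_pt g y t, t) |y t.
     y \<in> S \<and> 0 \<le> t \<and> tbar_s g y \<le> ennreal t \<and> ennreal t \<le> t_s g y}"

definition Sigma_set :: "(real ^ 'n \<Rightarrow> real) \<Rightarrow> ((real ^ 'n) \<times> real) set" where
  "Sigma_set g = {(x, t). 0 < t \<and> \<not> (\<lambda>(x, t). hopf_lax g x t) differentiable (at (x, t))}"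

definition T1_set :: "(real ^ 'n \<Rightarrow> real) \<Rightarrow> ((real ^ 'n) \<times> real) set" where
  "T1_set g = {(x, t). (x, t) \<in> T_set g (M_set g) \<and> (\<exists>!y. minimizer g x t y)}"

definition H_half :: "(real ^ 'n \<Rightarrow> real) \<Rightarrow> real ^ 'n \<Rightarrow> (real ^ 'n) set" where
  "H_half g y0 = {y. 0 < inner (y - y0) (grad g y0)}"

definition E_set :: "(real ^ 'n \<Rightarrow> real) \<Rightarrow> (real ^ 'n) set" where
  "E_set g = {y0. grad g y0 \<noteq> 0 \<and> (\<exists>y \<in> H_half g y0. g y < g y0)}"

text \<open>A small neighborhood \<open>N\<close> of \<open>y0\<close> on which the level set \<open>{g = g(y0)}\<close> is a hypersurface (all
  its points are regular, so it is one by the implicit function theorem) that separates \<open>N\<close>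
  into two connected sides.\<close>

definition separated_nbhd :: "(real ^ 'n \<Rightarrow> real) \<Rightarrow> real ^ 'n \<Rightarrow> (real ^ 'n) set \<Rightarrow> bool" where
  "separated_nbhd g y0 N \<longleftrightarrow> open N \<and> connected N \<and> y0 \<in> N \<and>
     (\<forall>y \<in> N. g y = g y0 \<longrightarrow> grad g y \<noteq> 0) \<and>
     {y \<in> N. g y > g y0} \<noteq> {} \<and> connected {y \<in> N. g y > g y0} \<and>
     {y \<in> N. g y < g y0} \<noteq> {} \<and> connected {y \<in> N. g y < g y0}"

definition H_plus :: "(real ^ 'n \<Rightarrow> real) \<Rightarrow> (real ^ 'n) set \<Rightarrow> real ^ 'n \<Rightarrow> (real ^ 'n) set" where
  "H_plus g N y0 = {y \<in> N. g y > g y0}"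

text \<open>The set \<open>F\<^sub>i\<close> belonging to the path component \<open>C = E\<^sub>i\<close> of \<open>E\<close>. Since \<open>U\<close> may be
  shrunk, the condition does not depend on which separated neighborhood \<open>N\<close> is used.\<close>

definition F_set :: "(real ^ 'n \<Rightarrow> real) \<Rightarrow> (real ^ 'n) set \<Rightarrow> (real ^ 'n) set" where
  "F_set g C = C \<union> {y0 \<in> M_set g - E_set g.
     \<exists>N. separated_nbhd g y0 N \<and> (\<exists>U. open U \<and> y0 \<in> U \<and> U \<inter> H_plus g N y0 \<subseteq> C)}"

end

theory Submission
  imports Defs
begin

text \<open>Write \<open>\<nu>(y)\<close> for the unit vector along \<open>Dg(y)\<close> and \<open>B\<^sub>t(y)\<close> for the closed ball of radius \<open>t\<close> that touches \<open>y\<close>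
from the side into which \<open>\<nu>(y)\<close> points. This is the ball over which \<open>u(X(y,t),t)\<close> is minimized, so \<open>y\<close> is
a minimizer for \<open>(X(y,t),t)\<close> iff \<open>g \<ge> g(y)\<close> on \<open>B\<^sub>t(y)\<close>, and the only one iff \<open>g > g(y)\<close> on the rest of
the ball. The balls \<open>B\<^sub>t(y)\<close> grow with \<open>t\<close>, each one lying in the interior of the next except for
the point \<open>y\<close>, and they exhaust the half space \<open>H\<^sub>y\<close>. Hence the times at which \<open>y\<close> is the unique
minimizer, respectively a minimizer, form initial intervals, and \<open>E\<close> consists of the points with \<open>Dg \<noteq> 0\<close> for which the second one
is bounded.

The identity \<open>\<Sigma> \<union> T\<^sub>1 = T(M)\<close> (\<open>Sigma_Un_T1_eq\<close>). With \<open>y = x + te\<close>, \<open>u\<close> is a minimum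
over the fixed unit ball of functions that are continuously differentiable in \<open>(x,t)\<close>; by Danskin's argument
(\<open>has_derivative_min_over_compact\<close>) \<open>u\<close> is differentiable wherever all minimizers yield the same
gradient. So a point of \<open>\<Sigma>\<close> has a minimizer with \<open>Dg \<noteq> 0\<close> and a second minimizer. Conversely a
derivative of \<open>u\<close> determines \<open>Dg\<close> at every minimizer, and a nonzero gradient at a minimizer \<open>y\<close> forces
\<open>x = X(y,t)\<close>; two minimizers, one of them with \<open>Dg \<noteq> 0\<close>, are therefore incompatible with
differentiability.

The identity \<open>M = \<Union>\<^sub>i F\<^sub>i\<close> (\<open>M_eq_Union_F_set\<close>). A point of \<open>M - E\<close> has a
competitor at its own level, so the nearby points at higher levels belong to \<open>E\<close>; in a small cylinder with axis
\<open>\<nu>\<close> they form a path connected set, which lies in one \<open>E\<^sub>i\<close>.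

Each \<open>T(F\<^sub>i)\<close> is path connected (\<open>path_connected_T_set_F_set\<close>). Over \<open>y \<in> E\<close> lies the
segment of times between the last time \<open>a(y)\<close> of unique minimality and the last time \<open>b(y)\<close> of
minimality. These times may jump, but the jumps are one-sided: when \<open>y\<close> tends to \<open>y\<^sub>0\<close>
within \<open>g < g(y\<^sub>0)\<close> both times tend to \<open>b(y\<^sub>0)\<close>, because a competitor of \<open>y\<close> that stays away from
\<open>y\<^sub>0\<close> would beat \<open>y\<^sub>0\<close>; within \<open>g > g(y\<^sub>0)\<close> both tend to \<open>a(y\<^sub>0)\<close>, because a competitor at the
level of \<open>y\<^sub>0\<close> beats \<open>y\<close>. Competitors that collapse onto \<open>y\<^sub>0\<close> are excluded by the Hessian of
\<open>g\<close> (\<open>no_competitors_near\<close>). Thus over a segment on which \<open>g\<close> strictly increases, the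
threshold times trace a graph whose downward jumps are filled by vertical segments. There may be
infinitely many jumps, of infinite total height, so arc length is no parameter; a continuous injective
real function that respects the order along the graph shows nevertheless that it is an arc
(\<open>path_connected_filled_graph\<close>). Two neighbouring points of \<open>E\<close> can climb to a common higher point
along such segments, and a point of \<open>F\<^sub>i - E\<^sub>i\<close> climbs into \<open>E\<^sub>i\<close>, so the connectedness of \<open>E\<^sub>i\<close>
carries over to \<open>T(F\<^sub>i)\<close>. Finally \<open>E\<close> is open, hence has at most countably many path components, and every path
component of \<open>\<Sigma> \<union> T\<^sub>1\<close> contains a nonempty \<open>T(F\<^sub>i)\<close>.\<close>

section \<open>Graphs with downward jumps\<close>

definition filled_graph :: "(real \<Rightarrow> real) \<Rightarrow> (real \<Rightarrow> real) \<Rightarrow> (real \<times> real) set" where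
  "filled_graph a b = {(s, t). s \<in> {0..1} \<and> a s \<le> t \<and> t \<le> b s}"

text \<open>Rises continuously from 0 to 1 while the graph descends along the vertical segment over \<open>r\<close>. At the
points \<open>r\<close> with \<open>a r = b r\<close> there is no segment and the value is the default of division by 0.\<close>

definition jump_ramp :: "(real \<Rightarrow> real) \<Rightarrow> (real \<Rightarrow> real) \<Rightarrow> real \<Rightarrow> real \<times> real \<Rightarrow> real" where
  "jump_ramp a b r = (\<lambda>(s, t). if s < r then 0 else if r < s then 1 else (b r - t) / (b r - a r))"

text \<open>Both boundary functions have the left limit \<open>b s\<close> and the right limit \<open>a s\<close> at \<open>s\<close>. The filled
graph is then the graph of a regulated function completed by the vertical segments at its jumps,
and it is traversed from left to right and downwards along the segments.\<close>

locale downward_jumps =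
  fixes a b :: "real \<Rightarrow> real"
  assumes le: "\<And>s. s \<in> {0..1} \<Longrightarrow> a s \<le> b s"
    and left: "\<And>s e. \<lbrakk>s \<in> {0..1}; 0 < e\<rbrakk> \<Longrightarrow>
      \<exists>d>0. \<forall>r\<in>{0..1}. s - d < r \<and> r < s \<longrightarrow> b s - e < a r \<and> b r < b s + e"
    and right: "\<And>s e. \<lbrakk>s \<in> {0..1}; 0 < e\<rbrakk> \<Longrightarrow>
      \<exists>d>0. \<forall>r\<in>{0..1}. s < r \<and> r < s + d \<longrightarrow> a s - e < a r \<and> b r < a s + e"
begin

lemma one_sided_limits:
  assumes "s \<in> {0..1}" "0 < e"
  obtains d where "0 < d"
    "\<And>r t. \<lbrakk>(r, t) \<in> filled_graph a b; \<bar>r - s\<bar> < d; r < s\<rbrakk> \<Longrightarrow> \<bar>t - b s\<bar> < e"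
    "\<And>r t. \<lbrakk>(r, t) \<in> filled_graph a b; \<bar>r - s\<bar> < d; s < r\<rbrakk> \<Longrightarrow> \<bar>t - a s\<bar> < e"
proof -
  obtain d1 where d1: "d1 > 0" "\<forall>r\<in>{0..1}. s - d1 < r \<and> r < s \<longrightarrow> b s - e < a r \<and> b r < b s + e"
    using left[OF assms] by blast
  obtain d2 where d2: "d2 > 0" "\<forall>r\<in>{0..1}. s < r \<and> r < s + d2 \<longrightarrow> a s - e < a r \<and> b r < a s + e"
    using right[OF assms] by blast
  show thesis
  proof (rule that[of "min d1 d2"])
    show "0 < min d1 d2" using d1 d2 by simp
    fix r t assume G: "(r, t) \<in> filled_graph a b" and "\<bar>r - s\<bar> < min d1 d2"
    then have r: "r \<in> {0..1}" "a r \<le> t" "t \<le> b r" "s - d1 < r" "r < s + d2"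
      by (auto simp: filled_graph_def)
    show "\<bar>t - b s\<bar> < e" if "r < s" using d1(2) r that by force
    show "\<bar>t - a s\<bar> < e" if "s < r" using d2(2) r that by force
  qed
qed

lemma near_fibre:
  assumes "s \<in> {0..1}" "0 < e"
  obtains d where "0 < d"
    "\<And>r t. \<lbrakk>(r, t) \<in> filled_graph a b; \<bar>r - s\<bar> < d\<rbrakk> \<Longrightarrow> a s - e < t \<and> t < b s + e"
proof -
  obtain d where d: "0 < d"
    "\<And>r t. \<lbrakk>(r, t) \<in> filled_graph a b; \<bar>r - s\<bar> < d; r < s\<rbrakk> \<Longrightarrow> \<bar>t - b s\<bar> < e"
    "\<And>r t. \<lbrakk>(r, t) \<in> filled_graph a b; \<bar>r - s\<bar> < d; s < r\<rbrakk> \<Longrightarrow> \<bar>t - a s\<bar> < e"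
    using one_sided_limits[OF assms] by metis
  show thesis
  proof (rule that[OF d(1)])
    fix r t assume G: "(r, t) \<in> filled_graph a b" and r: "\<bar>r - s\<bar> < d"
    consider "r < s" | "s < r" | "r = s" by linarith
    then show "a s - e < t \<and> t < b s + e"
    proof cases
      case 1 then show ?thesis using d(2)[OF G r] le[OF assms(1)] by linarith
    next
      case 2 then show ?thesis using d(3)[OF G r] le[OF assms(1)] by linarith
    next
      case 3 then show ?thesis using G assms(2) by (auto simp: filled_graph_def)
    qed
  qed
qed

text \<open>Closedness holds because every point of the graph near the vertical line over \<open>s\<close> has a height close to the
fibre \<open>{a s..b s}\<close>; boundedness follows by covering the unit interval.\<close>

lemma compact_filled_graph: "compact (filled_graph a b)"
proof -
  have "closed (filled_graph a b)"
  proof (subst closure_subset_eq[symmetric])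
    show "closure (filled_graph a b) \<subseteq> filled_graph a b"
    proof
      fix x assume x: "x \<in> closure (filled_graph a b)"
      obtain s t where st: "x = (s, t)" by fastforce
      have "filled_graph a b \<subseteq> {0..1} \<times> UNIV" by (auto simp: filled_graph_def)
      then have "closure (filled_graph a b) \<subseteq> {0..1} \<times> UNIV"
        by (intro closure_minimal closed_Times) auto
      with x st have s: "s \<in> {0..1}" by auto
      have "a s - e \<le> t \<and> t \<le> b s + e" if "e > 0" for e
      proof -
        obtain d where d: "0 < d"
          "\<And>r t. \<lbrakk>(r, t) \<in> filled_graph a b; \<bar>r - s\<bar> < d\<rbrakk> \<Longrightarrow> a s - e/2 < t \<and> t < b s + e/2"
          using near_fibre[OF s, of "e/2"] \<open>e > 0\<close> by (metis half_gt_zero)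
        have "min d (e/2) > 0" using d(1) that by simp
        then obtain y where y: "y \<in> filled_graph a b" "dist y x < min d (e/2)"
          using x closure_approachable by blast
        obtain r t' where rt: "y = (r, t')" by fastforce
        have "\<bar>r - s\<bar> < d" "\<bar>t' - t\<bar> < e/2"
          using y(2) dist_fst_le[of y x] dist_snd_le[of y x] by (auto simp: rt st dist_real_def)
        moreover have "a s - e/2 < t' \<and> t' < b s + e/2"
          using d(2) y(1) rt \<open>\<bar>r - s\<bar> < d\<close> by blast
        ultimately show ?thesis by (smt (verit) field_sum_of_halves)
      qed
      then have "a s \<le> t" "t \<le> b s"
        by (metis diff_le_eq field_le_epsilon, metis field_le_epsilon)
      with s st show "x \<in> filled_graph a b" by (simp add: filled_graph_def)
    qed
  qed
  moreover have "bounded (filled_graph a b)"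
  proof -
    have "\<exists>d>0. \<exists>B. \<forall>r t. (r, t) \<in> filled_graph a b \<and> \<bar>r - s\<bar> < d \<longrightarrow> \<bar>t\<bar> \<le> B" if s: "s \<in> {0..1}" for s
    proof -
      obtain d where "0 < d"
        "\<And>r t. \<lbrakk>(r, t) \<in> filled_graph a b; \<bar>r - s\<bar> < d\<rbrakk> \<Longrightarrow> a s - 1 < t \<and> t < b s + 1"
        using near_fibre[OF s, of 1] by (metis zero_less_one)
      then show ?thesis
        by (intro exI[of _ d] conjI exI[of _ "\<bar>a s\<bar> + \<bar>b s\<bar> + 1"]) (auto, fastforce)
    qed
    then obtain d B where d: "\<And>s. s \<in> {0..1} \<Longrightarrow> 0 < d s" and
      B: "\<And>s r t. \<lbrakk>s \<in> {0..1}; (r, t) \<in> filled_graph a b; \<bar>r - s\<bar> < d s\<rbrakk> \<Longrightarrow> \<bar>t\<bar> \<le> B s"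
      by metis
    have "{0..1} \<subseteq> (\<Union>s\<in>{0..1}. ball s (d s))" using d by auto
    then obtain F where F: "F \<subseteq> {0..1}" "finite F" "{0..1} \<subseteq> (\<Union>s\<in>F. ball s (d s))"
      using compactE_image[of "{0..1::real}" "{0..1}" "\<lambda>s. ball s (d s)"] by auto
    have "norm x \<le> 1 + (\<Sum>s\<in>F. \<bar>B s\<bar>)" if "x \<in> filled_graph a b" for x
    proof -
      obtain r t where rt: "x = (r, t)" by fastforce
      have r: "r \<in> {0..1}" using that rt by (auto simp: filled_graph_def)
      then obtain s where s: "s \<in> F" "r \<in> ball s (d s)" using F(3) by blast
      have "\<bar>t\<bar> \<le> B s" 
        by (rule B) (use s F that rt in \<open>auto simp: dist_real_def\<close>)
      also have "\<dots> \<le> \<bar>B s\<bar>" by simp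
      also have "\<dots> \<le> (\<Sum>s\<in>F. \<bar>B s\<bar>)" using s F by (intro member_le_sum) auto
      finally have "\<bar>t\<bar> \<le> (\<Sum>s\<in>F. \<bar>B s\<bar>)" .
      moreover have "norm x \<le> \<bar>r\<bar> + \<bar>t\<bar>" using norm_Pair_le[of r t] rt by simp
      moreover have "\<bar>r\<bar> \<le> 1" using r by auto
      ultimately show ?thesis by linarith
    qed
    then show ?thesis unfolding bounded_iff by blast
  qed
  ultimately show ?thesis by (simp add: compact_eq_bounded_closed)
qed

text \<open>The projection to the first coordinate is a closed map onto an interval with connected fibres.\<close>

lemma connected_filled_graph: "connected (filled_graph a b)"
proof -
  let ?G = "filled_graph a b"
  have "connected (?G \<inter> fst -` {0..1})"
  proof (rule connected_closed_monotone_preimage[where T = "{0..1}"])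
    show "continuous_on ?G fst" by (intro continuous_intros)
    show "fst ` ?G = {0..1}"
      using le by (force simp: filled_graph_def image_iff)
    show "closedin (top_of_set {0..1}) (fst ` C)" if "closedin (top_of_set ?G) C" for C
    proof (rule closed_subset)
      have "compact C" using that compact_filled_graph closedin_compact by blast
      then show "closed (fst ` C)"
        by (intro compact_imp_closed compact_continuous_image continuous_intros)
      show "fst ` C \<subseteq> {0..1}"
        using closedin_imp_subset[OF that] by (auto simp: filled_graph_def)
    qed
    show "connected (?G \<inter> fst -` {y})" if "y \<in> {0..1}" for y
    proof -
      have "?G \<inter> fst -` {y} = Pair y ` {a y..b y}"
        using that by (auto simp: filled_graph_def)
      then show ?thesis
        by (simp add: connected_continuous_image continuous_intros)
    qed
  qed auto
  moreover have "?G \<inter> fst -` {0..1} = ?G" by (auto simp: filled_graph_def)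
  ultimately show ?thesis by simp
qed

text \<open>At an accumulation point of jumps of height at least \<open>e\<close>, both ends of these jumps would have to
converge to the same one-sided limit.\<close>

lemma finite_large_jumps:
  assumes "0 < e" shows "finite {s \<in> {0..1}. e \<le> b s - a s}"
proof (rule ccontr)
  let ?J = "{s \<in> {0..1}. e \<le> b s - a s}"
  assume "infinite ?J"
  then obtain s where s: "s \<in> {0..1}" "s islimpt ?J"
    using compact_eq_Bolzano_Weierstrass[of "{0..1::real}"] compact_Icc[of 0 "1::real"]
    by (metis (no_types, lifting) mem_Collect_eq subsetI)
  obtain d where d: "0 < d"
    "\<And>r t. \<lbrakk>(r, t) \<in> filled_graph a b; \<bar>r - s\<bar> < d; r < s\<rbrakk> \<Longrightarrow> \<bar>t - b s\<bar> < e/2"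
    "\<And>r t. \<lbrakk>(r, t) \<in> filled_graph a b; \<bar>r - s\<bar> < d; s < r\<rbrakk> \<Longrightarrow> \<bar>t - a s\<bar> < e/2"
    using one_sided_limits[OF s(1), of "e/2"] \<open>0 < e\<close> by (metis half_gt_zero)
  obtain r where r: "r \<in> ?J" "r \<noteq> s" "dist r s < d"
    using s(2) d(1) by (auto simp: islimpt_approachable)
  then have "(r, a r) \<in> filled_graph a b" "(r, b r) \<in> filled_graph a b" "\<bar>r - s\<bar> < d"
    using le[of r] by (auto simp: filled_graph_def dist_real_def)
  moreover have "e \<le> b r - a r" using r by simp
  moreover have "r < s \<or> s < r" using r(2) by linarith
  ultimately show False
    using d(2)[of r "a r"] d(2)[of r "b r"] d(3)[of r "a r"] d(3)[of r "b r"]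
    by (smt (verit) field_sum_of_halves)
qed

lemma countable_jumps: "countable {s \<in> {0..1}. a s < b s}"
proof -
  have "{s \<in> {0..1}. a s < b s} \<subseteq> (\<Union>n. {s \<in> {0..1}. inverse (real (Suc n)) \<le> b s - a s})"
  proof
    fix s assume s: "s \<in> {s \<in> {0..1}. a s < b s}"
    then have "0 < b s - a s" by simp
    then obtain n where "inverse (real (Suc n)) < b s - a s"
      using reals_Archimedean by blast
    then have "s \<in> {s \<in> {0..1}. inverse (real (Suc n)) \<le> b s - a s}"
      using s by (simp del: of_nat_Suc add: less_imp_le)
    then show "s \<in> (\<Union>n. {s \<in> {0..1}. inverse (real (Suc n)) \<le> b s - a s})"
      by blast
  qed
  moreover have "countable (\<Union>n. {s \<in> {0..1}. inverse (real (Suc n)) \<le> b s - a s})"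
    by (rule countable_UN[OF countableI_type], rule countable_finite, rule finite_large_jumps) simp
  ultimately show ?thesis by (rule countable_subset)
qed

lemma jump_ramp_range:
  assumes "x \<in> filled_graph a b" shows "0 \<le> jump_ramp a b r x" "jump_ramp a b r x \<le> 1"
proof -
  obtain s t where x: "x = (s, t)" by fastforce
  with assms have "a s \<le> t" "t \<le> b s" by (auto simp: filled_graph_def)
  then show "0 \<le> jump_ramp a b r x" "jump_ramp a b r x \<le> 1"
    by (auto simp: jump_ramp_def x divide_le_eq_1)
qed

text \<open>Continuity is at stake only over \<open>r\<close>: points of the graph close to the upper end of
the segment over \<open>r\<close> may lie to the left, where the ramp is 0, and points close to the lower end may lie to the right,
where it is 1. The one-sided limits exclude every other approach to the segment.\<close>

lemma continuous_on_jump_ramp: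
  assumes r: "r \<in> {0..1}" "a r < b r"
  shows "continuous_on (filled_graph a b) (jump_ramp a b r)"
  unfolding continuous_on_iff
proof (intro ballI allI impI)
  fix x and e :: real assume x: "x \<in> filled_graph a b" and e: "0 < e"
  let ?c = "b r - a r"
  obtain s t where st: "x = (s, t)" by fastforce
  consider "s < r" | "r < s" | "s = r" by linarith
  then show "\<exists>d>0. \<forall>y\<in>filled_graph a b. dist y x < d \<longrightarrow>
      dist (jump_ramp a b r y) (jump_ramp a b r x) < e"
  proof cases
    case 1
    show ?thesis
    proof (intro exI[of _ "r - s"] conjI ballI impI)
      fix y assume "dist y x < r - s"
      then have "fst y < r" using dist_fst_le[of y x] by (auto simp: st dist_real_def)
      then show "dist (jump_ramp a b r y) (jump_ramp a b r x) < e"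
        using 1 e by (auto simp: jump_ramp_def st split: prod.split)
    qed (use 1 in simp)
  next
    case 2
    show ?thesis
    proof (intro exI[of _ "s - r"] conjI ballI impI)
      fix y assume "dist y x < s - r"
      then have "fst y > r" using dist_fst_le[of y x] by (auto simp: st dist_real_def)
      then show "dist (jump_ramp a b r y) (jump_ramp a b r x) < e"
        using 2 e by (auto simp: jump_ramp_def st split: prod.split)
    qed (use 2 in simp)
  next
    case 3
    have ec: "e / 2 * ?c > 0" using e r by simp
    obtain d where d: "0 < d"
      "\<And>s t. \<lbrakk>(s, t) \<in> filled_graph a b; \<bar>s - r\<bar> < d; s < r\<rbrakk> \<Longrightarrow> \<bar>t - b r\<bar> < e / 2 * ?c"
      "\<And>s t. \<lbrakk>(s, t) \<in> filled_graph a b; \<bar>s - r\<bar> < d; r < s\<rbrakk> \<Longrightarrow> \<bar>t - a r\<bar> < e / 2 * ?c"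
      using one_sided_limits[OF r(1) ec] by metis
    show ?thesis
    proof (intro exI[of _ "min d (e / 2 * ?c)"] conjI ballI impI)
      show "0 < min d (e / 2 * ?c)" using d(1) ec by simp
      fix y assume y: "y \<in> filled_graph a b" and dy: "dist y x < min d (e / 2 * ?c)"
      obtain s' t' where st': "y = (s', t')" by fastforce
      have *: "\<bar>s' - r\<bar> < d" "\<bar>t' - t\<bar> < e / 2 * ?c"
        using dy dist_fst_le[of y x] dist_snd_le[of y x] by (auto simp: st st' dist_real_def 3)
      have jx: "jump_ramp a b r x = (b r - t) / ?c" using 3 by (simp add: jump_ramp_def st)
      have half: "e / 2 * ?c + e / 2 * ?c = e * ?c" by (simp add: algebra_simps)
      have key: "\<bar>jump_ramp a b r y - jump_ramp a b r x\<bar> * ?c < e * ?c"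
      proof -
        consider "s' < r" | "r < s'" | "s' = r" by linarith
        then show ?thesis
        proof cases
          case 1
          have "\<bar>t' - b r\<bar> < e / 2 * ?c" using d(2) y * 1 st' by blast
          moreover have "jump_ramp a b r y = 0"
            using 1 by (simp add: jump_ramp_def st')
          then have "\<bar>jump_ramp a b r y - jump_ramp a b r x\<bar> * ?c = \<bar>t - b r\<bar>"
            unfolding jx using r by (simp add: abs_divide)
          ultimately show ?thesis using *(2) half by linarith
        next
          case 2
          have "\<bar>t' - a r\<bar> < e / 2 * ?c" using d(3) y * 2 st' by blast
          moreover have "(1 - (b r - t) / ?c) * ?c = t - a r"
            using r by (simp add: field_simps)
          then have "\<bar>jump_ramp a b r y - jump_ramp a b r x\<bar> * ?c = \<bar>t - a r\<bar>"
            unfolding jx using 2 r by (simp add: jump_ramp_def st' abs_mult_pos)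
          ultimately show ?thesis using *(2) half by linarith
        next
          case 3
          have "((b r - t') / ?c - (b r - t) / ?c) * ?c = t - t'"
            using r by (simp flip: diff_divide_distrib)
          then have "\<bar>jump_ramp a b r y - jump_ramp a b r x\<bar> * ?c = \<bar>t - t'\<bar>"
            unfolding jx using 3 r by (simp add: jump_ramp_def st' abs_mult_pos)
          then show ?thesis using *(2) ec half by linarith
        qed
      qed
      then show "dist (jump_ramp a b r y) (jump_ramp a b r x) < e"
        using r by (simp add: dist_real_def)
    qed
  qed
qed

lemma jump_ramp_mono:
  assumes "(s, t) \<in> filled_graph a b" "(s', t') \<in> filled_graph a b" "s < s'"
  shows "jump_ramp a b r (s, t) \<le> jump_ramp a b r (s', t')"
proof (cases "s < r")
  case True
  then show ?thesis using jump_ramp_range(1)[OF assms(2)] by (simp add: jump_ramp_def)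
next
  case False
  then have "jump_ramp a b r (s', t') = 1" using assms by (simp add: jump_ramp_def)
  then show ?thesis using jump_ramp_range(2)[OF assms(1)] by simp
qed

lemma jump_ramp_mono_fibre:
  assumes "(s, t) \<in> filled_graph a b" "(s, t') \<in> filled_graph a b" "t' \<le> t"
  shows "jump_ramp a b r (s, t) \<le> jump_ramp a b r (s, t')"
  using assms by (auto simp: jump_ramp_def filled_graph_def divide_right_mono)

text \<open>Adding to the first coordinate a weighted sum of the ramps of all jumps gives a continuous function
that is strictly increasing in the order in which the graph is traversed: the first coordinate separates different
fibres and the ramp at \<open>s\<close> separates the points over \<open>s\<close>. The geometric weights make the sum
converge although the heights of the jumps need not be summable. A continuous injective real function on a
compact connected set is a homeomorphism onto an interval.\<close>

proposition path_connected_filled_graph: "path_connected (filled_graph a b)"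
proof -
  let ?G = "filled_graph a b"
  define J where "J = {s \<in> {0..1}. a s < b s}"
  \<comment> \<open>The point 2, whose ramp vanishes on the graph, makes the enumerated set nonempty.\<close>
  define c where "c = from_nat_into (insert 2 J)"
  have c_range: "range c = insert 2 J"
    unfolding c_def using countable_jumps by (intro range_from_nat_into) (auto simp: J_def)
  define f where "f = (\<lambda>n x. (1/2)^n * jump_ramp a b (c n) x)"
  define p where "p = (\<lambda>x. fst x + (\<Sum>n. f n x))"
  have f_cont: "continuous_on ?G (f n)" for n
  proof (cases "c n = 2")
    case True
    then have "f n x = 0" if "x \<in> ?G" for x
      using that by (auto simp: f_def jump_ramp_def filled_graph_def split: prod.split)
    then show ?thesis by (simp add: continuous_on_cong[of ?G ?G "f n" "\<lambda>_. 0"])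
  next
    case False
    then have "c n \<in> J" using c_range by (metis insertE rangeI)
    then show ?thesis unfolding f_def J_def
      by (intro continuous_intros continuous_on_jump_ramp) auto
  qed
  have f_bound: "norm (f n x) \<le> (1/2)^n" if "x \<in> ?G" for n x
    using jump_ramp_range[OF that, of "c n"] by (simp add: f_def abs_mult mult_left_le)
  have geo: "summable (\<lambda>n. (1/2::real)^n)" by (simp add: summable_geometric)
  have f_summable: "summable (\<lambda>n. f n x)" if "x \<in> ?G" for x
    using f_bound[OF that] geo by (rule summable_comparison_test'[where N=0, rotated])
  have "uniform_limit ?G (\<lambda>n x. \<Sum>i<n. f i x) (\<lambda>x. \<Sum>i. f i x) sequentially"
    using f_bound geo by (rule Weierstrass_m_test)
  then have "continuous_on ?G (\<lambda>x. \<Sum>i. f i x)"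
    by (rule uniform_limit_theorem[rotated])
       (auto intro!: always_eventually continuous_on_sum f_cont)
  then have p_cont: "continuous_on ?G p"
    unfolding p_def by (intro continuous_intros)
  have lt1: "p (s, t) < p (s', t')" if "(s, t) \<in> ?G" "(s', t') \<in> ?G" "s < s'" for s t s' t'
  proof -
    have "(\<Sum>n. f n (s, t)) \<le> (\<Sum>n. f n (s', t'))"
      using that by (intro suminf_le f_summable) (auto simp: f_def jump_ramp_mono)
    with that show ?thesis by (simp add: p_def)
  qed
  have lt2: "p (s, t) < p (s, t')" if "(s, t) \<in> ?G" "(s, t') \<in> ?G" "t' < t" for s t t'
  proof -
    have "a s < b s" "s \<in> {0..1}" using that by (auto simp: filled_graph_def)
    then have "s \<in> J" by (simp add: J_def)
    then obtain k where k: "c k = s" using c_range by (metis insertI2 rangeE)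
    have le: "f n (s, t) \<le> f n (s, t')" for n
      using that by (auto simp: f_def jump_ramp_mono_fibre)
    have "f k (s, t) < f k (s, t')"
      using \<open>a s < b s\<close> that by (auto simp: f_def jump_ramp_def k divide_strict_right_mono)
    then have "(\<Sum>n. f n (s, t)) < (\<Sum>n. f n (s, t'))"
      using suminf_pos2[of "\<lambda>n. f n (s, t') - f n (s, t)" k] le
        suminf_diff[OF f_summable[OF that(2)] f_summable[OF that(1)]]
        summable_diff[OF f_summable[OF that(2)] f_summable[OF that(1)]]
      by simp
    then show ?thesis by (simp add: p_def)
  qed
  have "inj_on p ?G"
  proof (rule inj_onI)
    fix x y assume xy: "x \<in> ?G" "y \<in> ?G" "p x = p y"
    obtain s t s' t' where st: "x = (s, t)" "y = (s', t')" by fastforce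
    have "\<not> s < s'" "\<not> s' < s" using lt1[of s t s' t'] lt1[of s' t' s t] xy st by auto
    then have s: "s = s'" by simp
    have "\<not> t < t'" "\<not> t' < t" using lt2[of s t t'] lt2[of s t' t] xy st s by auto
    with s st show "x = y" by simp
  qed
  then obtain q where q: "homeomorphism ?G (p ` ?G) p q"
    using homeomorphism_compact[OF compact_filled_graph p_cont refl] by blast
  have "connected (p ` ?G)"
    by (rule connected_continuous_image[OF p_cont connected_filled_graph])
  then have "path_connected (p ` ?G)"
    by (simp flip: is_interval_connected_1 is_interval_path_connected_1)
  then have "path_connected (q ` p ` ?G)"
    using homeomorphism_cont2[OF q] by (rule path_connected_continuous_image[rotated])
  moreover have "q ` p ` ?G = ?G" using q by (simp add: homeomorphism_def)
  ultimately show ?thesis by argo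
qed

end

section \<open>Minima over a compact parameter set\<close>

lemma mean_value_along_segment:
  fixes f :: "'a::real_inner \<Rightarrow> real"
  assumes "\<And>x. x \<in> closed_segment a b \<Longrightarrow> (f has_derivative (\<lambda>h. h \<bullet> D x)) (at x)"
  obtains x where "x \<in> closed_segment a b" "f b - f a = (b - a) \<bullet> D x"
proof -
  let ?c = "\<lambda>s. a + s *\<^sub>R (b - a)"
  have seg: "?c s \<in> closed_segment a b" if "0 \<le> s" "s \<le> 1" for s
    using that by (auto simp: closed_segment_def algebra_simps intro!: exI[of _ s])
  have "((\<lambda>s. f (?c s)) has_derivative (\<lambda>k. (k *\<^sub>R (b - a)) \<bullet> D (?c s))) (at s within {0..1})"
    if "0 \<le> s" "s \<le> 1" for s
  proof (rule has_derivative_compose[where f = ?c and g = f, unfolded o_def])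
    show "(?c has_derivative (\<lambda>k. k *\<^sub>R (b - a))) (at s within {0..1})"
      by (auto intro!: derivative_eq_intros)
    show "(f has_derivative (\<lambda>h. h \<bullet> D (?c s))) (at (?c s))"
      by (rule assms[OF seg[OF that]])
  qed
  from mvt_very_simple[OF zero_le_one this]
  obtain s where "s \<in> {0..1}" "f (?c 1) - f (?c 0) = ((1 - 0) *\<^sub>R (b - a)) \<bullet> D (?c s)"
    by blast
  with that[of "?c s"] seg[of s] show thesis by auto
qed

text \<open>A compactness argument: minimizers for \<open>z\<close> accumulate, as \<open>z\<close> tends to \<open>z0\<close>, only at minimizers for
\<open>z0\<close>, and there the gradient is \<open>L\<close>.\<close>

lemma minimizers_gradient_near:
  fixes f :: "'z::metric_space \<Rightarrow> 'e::metric_space \<Rightarrow> real" and G :: "'z \<Rightarrow> 'e \<Rightarrow> 'w::metric_space"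
  assumes K: "compact K" and S: "open S" "z0 \<in> S"
    and m: "\<And>z. z \<in> S \<Longrightarrow> \<exists>e\<in>K. f z e = m z" "\<And>z e. \<lbrakk>z \<in> S; e \<in> K\<rbrakk> \<Longrightarrow> m z \<le> f z e"
    and cf: "continuous_on (S \<times> K) (\<lambda>(z, e). f z e)"
    and cG: "continuous_on (S \<times> K) (\<lambda>(z, e). G z e)"
    and same: "\<And>e. \<lbrakk>e \<in> K; f z0 e = m z0\<rbrakk> \<Longrightarrow> G z0 e = L"
    and "0 < \<epsilon>"
  obtains d where "0 < d" "ball z0 d \<subseteq> S"
    "\<And>z y e. \<lbrakk>dist z z0 < d; dist y z0 < d; e \<in> K; f z e = m z\<rbrakk> \<Longrightarrow> dist (G y e) L < \<epsilon>"
proof (rule ccontr)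
  assume no: "\<not> thesis"
  obtain r where r: "0 < r" "ball z0 r \<subseteq> S" using S open_contains_ball by blast
  have "\<exists>z y e. dist z z0 < min r (inverse (Suc n)) \<and> dist y z0 < min r (inverse (Suc n)) \<and> e \<in> K \<and>
      f z e = m z \<and> \<epsilon> \<le> dist (G y e) L" for n
  proof (rule ccontr)
    assume *: "\<nexists>z y e. dist z z0 < min r (inverse (Suc n)) \<and> dist y z0 < min r (inverse (Suc n)) \<and> e \<in> K \<and>
      f z e = m z \<and> \<epsilon> \<le> dist (G y e) L"
    show False
    proof (rule no[THEN notE], rule that[of "min r (inverse (Suc n))"])
      show "0 < min r (inverse (real (Suc n)))" using r by simp
      show "ball z0 (min r (inverse (real (Suc n)))) \<subseteq> S" using r by auto
    qed (use * in \<open>meson not_le\<close>)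
  qed
  then obtain z y e where zye: "\<And>n. dist (z n) z0 < min r (inverse (Suc n))"
    "\<And>n. dist (y n) z0 < min r (inverse (Suc n))" "\<And>n. e n \<in> K"
    "\<And>n. f (z n) (e n) = m (z n)" "\<And>n. \<epsilon> \<le> dist (G (y n) (e n)) L"
    by metis
  have lim: "x \<longlonglongrightarrow> z0" if "\<And>n. dist (x n) z0 < min r (inverse (Suc n))" for x
    unfolding tendsto_dist_iff[of x]
    by (rule tendsto_sandwich[OF _ _ tendsto_const LIMSEQ_inverse_real_of_nat])
       (use that in \<open>auto intro!: always_eventually simp: less_imp_le simp del: of_nat_Suc\<close>)
  have inS: "x \<in> S" if "dist x z0 < min r c" for x c
    using that r by (auto simp: dist_commute)
  obtain e0 \<sigma> where e0: "e0 \<in> K" "strict_mono (\<sigma> :: nat \<Rightarrow> nat)" "(e \<circ> \<sigma>) \<longlonglongrightarrow> e0"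
    using K zye(3) unfolding compact_def by blast
  have z: "(\<lambda>n. z (\<sigma> n)) \<longlonglongrightarrow> z0" and y: "(\<lambda>n. y (\<sigma> n)) \<longlonglongrightarrow> z0"
    using LIMSEQ_subseq_LIMSEQ[OF lim[OF zye(1)] e0(2)] LIMSEQ_subseq_LIMSEQ[OF lim[OF zye(2)] e0(2)]
    by (simp_all add: o_def)
  have e: "(\<lambda>n. e (\<sigma> n)) \<longlonglongrightarrow> e0" using e0 by (simp add: o_def)
  have f_lim: "(\<lambda>n. f (x n) (c n)) \<longlonglongrightarrow> f z0 c0"
    if "x \<longlonglongrightarrow> z0" "c \<longlonglongrightarrow> c0" "c0 \<in> K" "\<And>n. x n \<in> S" "\<And>n. c n \<in> K" for x c c0
    using continuous_on_tendsto_compose[OF cf tendsto_Pair[OF that(1,2)]] that S(2) by simp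
  have G_lim: "(\<lambda>n. G (y (\<sigma> n)) (e (\<sigma> n))) \<longlonglongrightarrow> G z0 e0"
    using continuous_on_tendsto_compose[OF cG tendsto_Pair[OF y e]] e0 S(2) zye(3) inS[OF zye(2)] by simp
  obtain e1 where e1: "e1 \<in> K" "f z0 e1 = m z0" using m(1)[OF S(2)] by blast
  have zS: "z n \<in> S" for n by (rule inS[OF zye(1)])
  have "f z0 e0 \<le> f z0 e1"
  proof (rule LIMSEQ_le)
    show "(\<lambda>n. f (z (\<sigma> n)) (e (\<sigma> n))) \<longlonglongrightarrow> f z0 e0"
      by (rule f_lim[OF z e]) (use e0 zye zS in auto)
    show "(\<lambda>n. f (z (\<sigma> n)) e1) \<longlonglongrightarrow> f z0 e1"
      by (rule f_lim[OF z tendsto_const]) (use e1 zS in auto)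
    show "\<exists>N. \<forall>n\<ge>N. f (z (\<sigma> n)) (e (\<sigma> n)) \<le> f (z (\<sigma> n)) e1"
      using zye(4) m(2)[OF zS e1(1)] by auto
  qed
  then have "f z0 e0 = m z0" using m(2)[OF S(2) e0(1)] e1 by simp
  then have "G z0 e0 = L" by (rule same[OF e0(1)])
  then have "(\<lambda>n. dist (G (y (\<sigma> n)) (e (\<sigma> n))) L) \<longlonglongrightarrow> 0"
    using G_lim by (simp add: tendsto_dist_iff[symmetric])
  then have "\<epsilon> \<le> 0"
    by (rule LIMSEQ_le_const) (use zye(5) in auto)
  with \<open>0 < \<epsilon>\<close> show False by simp
qed

text \<open>Danskin's theorem for the case in which all minimizers at \<open>z0\<close> share the gradient \<open>L\<close>. The increment
of the minimum is squeezed between the increment of \<open>f\<close> at a minimizer for \<open>z\<close> and the one at a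
minimizer for \<open>z0\<close>; by the mean value theorem both are \<open>L\<close> up to a small multiple of the distance.\<close>

proposition has_derivative_min_over_compact:
  fixes f :: "'z::real_inner \<Rightarrow> 'e::metric_space \<Rightarrow> real" and G :: "'z \<Rightarrow> 'e \<Rightarrow> 'z"
  assumes K: "compact K" and S: "open S" "z0 \<in> S"
    and m: "\<And>z. z \<in> S \<Longrightarrow> \<exists>e\<in>K. f z e = m z" "\<And>z e. \<lbrakk>z \<in> S; e \<in> K\<rbrakk> \<Longrightarrow> m z \<le> f z e"
    and der: "\<And>z e. \<lbrakk>z \<in> S; e \<in> K\<rbrakk> \<Longrightarrow> ((\<lambda>z. f z e) has_derivative (\<lambda>h. h \<bullet> G z e)) (at z)"
    and cf: "continuous_on (S \<times> K) (\<lambda>(z, e). f z e)"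
    and cG: "continuous_on (S \<times> K) (\<lambda>(z, e). G z e)"
    and same: "\<And>e. \<lbrakk>e \<in> K; f z0 e = m z0\<rbrakk> \<Longrightarrow> G z0 e = L"
  shows "(m has_derivative (\<lambda>h. h \<bullet> L)) (at z0)"
  unfolding has_derivative_at_alt
proof (intro conjI allI impI)
  show "bounded_linear (\<lambda>h. h \<bullet> L)" by (rule bounded_linear_inner_left)
  fix \<epsilon> :: real assume "0 < \<epsilon>"
  obtain d where d: "0 < d" "ball z0 d \<subseteq> S"
    "\<And>z y e. \<lbrakk>dist z z0 < d; dist y z0 < d; e \<in> K; f z e = m z\<rbrakk> \<Longrightarrow> dist (G y e) L < \<epsilon>"
    using minimizers_gradient_near[OF K S m cf cG same \<open>0 < \<epsilon>\<close>] by metis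
  show "\<exists>d>0. \<forall>z. norm (z - z0) < d \<longrightarrow> norm (m z - m z0 - (z - z0) \<bullet> L) \<le> \<epsilon> * norm (z - z0)"
  proof (intro exI[of _ d] conjI allI impI d(1))
    fix z assume "norm (z - z0) < d"
    then have z: "dist z z0 < d" by (simp add: dist_norm)
    have seg: "closed_segment z0 z \<subseteq> ball z0 d"
      using z d(1) by (intro closed_segment_subset) (auto simp: dist_commute)
    have zS: "z \<in> S" using z d(2) by (auto simp: dist_commute)
    have incr: "\<bar>f z e - f z0 e - (z - z0) \<bullet> L\<bar> \<le> \<epsilon> * norm (z - z0)"
      if e: "e \<in> K" and w: "dist w z0 < d" "f w e = m w" for e w
    proof -
      obtain y where y: "y \<in> closed_segment z0 z" "f z e - f z0 e = (z - z0) \<bullet> G y e"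
        using mean_value_along_segment[of z0 z "\<lambda>z. f z e" "\<lambda>z. G z e"] der[OF _ e] seg d(2) by blast
      have "dist y z0 < d" using seg y(1) by (auto simp: dist_commute)
      then have "norm (G y e - L) \<le> \<epsilon>"
        using d(3)[OF w(1) _ e w(2)] by (auto simp: dist_norm less_imp_le)
      then have "norm (z - z0) * norm (G y e - L) \<le> norm (z - z0) * \<epsilon>"
        by (intro mult_left_mono) auto
      moreover have "f z e - f z0 e - (z - z0) \<bullet> L = (z - z0) \<bullet> (G y e - L)"
        using y(2) by (simp add: inner_diff_right)
      ultimately show ?thesis
        using Cauchy_Schwarz_ineq2[of "z - z0" "G y e - L"] by (simp add: mult.commute)
    qed
    obtain e0 where e0: "e0 \<in> K" "f z0 e0 = m z0" using m(1)[OF S(2)] by blast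
    obtain e where e: "e \<in> K" "f z e = m z" using m(1)[OF zS] by blast
    have "m z \<le> f z e0" "m z0 \<le> f z0 e" using m(2) zS S(2) e0 e by auto
    moreover have "\<bar>f z e0 - f z0 e0 - (z - z0) \<bullet> L\<bar> \<le> \<epsilon> * norm (z - z0)"
      by (rule incr[OF e0(1) _ e0(2)]) (use d in simp)
    moreover have "\<bar>f z e - f z0 e - (z - z0) \<bullet> L\<bar> \<le> \<epsilon> * norm (z - z0)"
      by (rule incr[OF e(1) z e(2)])
    ultimately show "norm (m z - m z0 - (z - z0) \<bullet> L) \<le> \<epsilon> * norm (z - z0)"
      using e0 e by auto
  qed
qed

section \<open>Calculus of twice continuously differentiable functions\<close>

lemma C2_has_derivative:
  assumes "C2 g" shows "(g has_derivative (\<lambda>h. h \<bullet> grad g y)) (at y)"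
  using assms GDERIV_grad[of g y] by (simp add: C2_def gderiv_def)

lemma C2_continuous_on: assumes "C2 g" shows "continuous_on S g"
  by (rule has_derivative_continuous_on) (rule has_derivative_at_withinI[OF C2_has_derivative[OF assms]])

lemma C2_continuous_on_grad: assumes "C2 g" shows "continuous_on S (grad g)"
proof -
  obtain H where "\<And>y. (grad g has_derivative blinfun_apply (H y)) (at y)"
    using assms by (auto simp: C2_def)
  then show ?thesis
    by (intro has_derivative_continuous_on[of S "grad g" "\<lambda>y. blinfun_apply (H y)"])
       (rule has_derivative_at_withinI)
qed

text \<open>Taylor's formula with the Hessian at an intermediate point, together with the continuity of the
Hessian.\<close>

lemma C2_hessian:
  fixes g :: "real ^ 'n \<Rightarrow> real"
  assumes "C2 g"
  obtains H :: "real ^ 'n \<Rightarrow> (real ^ 'n) \<Rightarrow>\<^sub>L (real ^ 'n)" where "continuous_on UNIV H"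
    "\<And>y z. \<exists>x\<in>closed_segment y z.
        g z = g y + (z - y) \<bullet> grad g y + ((z - y) \<bullet> H x (z - y)) / 2"
proof -
  obtain H :: "real ^ 'n \<Rightarrow> (real ^ 'n) \<Rightarrow>\<^sub>L (real ^ 'n)" where H: "continuous_on UNIV H"
    "\<And>y. (grad g has_derivative blinfun_apply (H y)) (at y)"
    using assms by (auto simp: C2_def)
  have "\<exists>x\<in>closed_segment y z.
        g z = g y + (z - y) \<bullet> grad g y + ((z - y) \<bullet> H x (z - y)) / 2" for y z
  proof -
    let ?h = "z - y" and ?c = "\<lambda>s::real. y + s *\<^sub>R (z - y)"
    define diff where "diff = (\<lambda>m s. if m = 0 then g (?c s) else if m = Suc 0 then ?h \<bullet> grad g (?c s)
      else ?h \<bullet> H (?c s) ?h)"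
    have c: "(?c has_derivative (\<lambda>k. k *\<^sub>R ?h)) (at s)" for s
      by (auto intro!: derivative_eq_intros)
    have d0: "((\<lambda>s. g (?c s)) has_derivative (\<lambda>k. (k *\<^sub>R ?h) \<bullet> grad g (?c s))) (at s)" for s
      by (rule has_derivative_compose[OF c C2_has_derivative[OF assms], unfolded o_def])
    have "((\<lambda>s. grad g (?c s)) has_derivative (\<lambda>k. H (?c s) (k *\<^sub>R ?h))) (at s)" for s
      by (rule has_derivative_compose[OF c H(2), unfolded o_def])
    then have d1: "((\<lambda>s. ?h \<bullet> grad g (?c s)) has_derivative (\<lambda>k. ?h \<bullet> H (?c s) (k *\<^sub>R ?h))) (at s)" for s
      by (rule has_derivative_inner_right)
    have "DERIV (diff m) s :> diff (Suc m) s" if "m < 2" for m s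
    proof -
      from that consider "m = 0" | "m = Suc 0" by linarith
      then show ?thesis
      proof cases
        case 1
        have "(\<lambda>k. (k *\<^sub>R ?h) \<bullet> grad g (?c s)) = (*) (?h \<bullet> grad g (?c s))"
          by (simp add: fun_eq_iff mult.commute)
        with 1 d0[of s] show ?thesis
          by (simp add: diff_def has_field_derivative_def)
      next
        case 2
        have "(\<lambda>k. ?h \<bullet> H (?c s) (k *\<^sub>R ?h)) = (*) (?h \<bullet> H (?c s) ?h)"
          by (simp add: fun_eq_iff blinfun.scaleR_right mult.commute)
        with 2 d1[of s] show ?thesis
          by (simp add: diff_def has_field_derivative_def)
      qed
    qed
    then have D: "\<forall>m s. m < 2 \<and> 0 \<le> s \<and> s \<le> 1 \<longrightarrow> DERIV (diff m) s :> diff (Suc m) s"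
      by blast
    have "\<exists>s. 0 < s \<and> s < 1 \<and>
      diff 0 1 = (\<Sum>m<2. (diff m 0 / fact m) * (1 - 0)^m) + (diff 2 s / fact 2) * (1 - 0)^2"
      by (rule Taylor_up[OF _ refl D order_refl zero_less_one]) simp
    then obtain s where s: "0 < s" "s < 1" and
      eq: "diff 0 1 = (\<Sum>m<2. (diff m 0 / fact m) * (1 - 0)^m) + (diff 2 s / fact 2) * (1 - 0)^2"
      by blast
    have "?c s \<in> closed_segment y z"
      using s by (auto simp: closed_segment_def algebra_simps intro!: exI[of _ s])
    moreover have "g z = g y + ?h \<bullet> grad g y + (?h \<bullet> H (?c s) ?h) / 2"
      using eq by (simp add: diff_def numeral_2_eq_2)
    ultimately show ?thesis by blast
  qed
  with H(1) show thesis by (rule that)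
qed

section \<open>Tangent balls and the two threshold times\<close>

definition grad_dir :: "(real ^ 'n \<Rightarrow> real) \<Rightarrow> real ^ 'n \<Rightarrow> real ^ 'n" where
  "grad_dir g y = grad g y /\<^sub>R norm (grad g y)"

text \<open>For \<open>t \<ge> 0\<close> and nonzero gradient this is the ball of radius \<open>t\<close> around \<open>char_pt g y t\<close>. The quadratic
inequality makes its growth in \<open>t\<close> and its dependence on \<open>y\<close> visible; for zero gradient it
describes just \<open>{y}\<close>.\<close>

definition tangent_ball :: "(real ^ 'n \<Rightarrow> real) \<Rightarrow> real ^ 'n \<Rightarrow> real \<Rightarrow> (real ^ 'n) set" where
  "tangent_ball g y t = {z. (norm (z - y))\<^sup>2 \<le> 2 * t * ((z - y) \<bullet> grad_dir g y)}"

definition min_at :: "(real ^ 'n \<Rightarrow> real) \<Rightarrow> real ^ 'n \<Rightarrow> real \<Rightarrow> bool" where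
  "min_at g y t \<longleftrightarrow> (\<forall>z \<in> tangent_ball g y t. g y \<le> g z)"

definition strict_min_at :: "(real ^ 'n \<Rightarrow> real) \<Rightarrow> real ^ 'n \<Rightarrow> real \<Rightarrow> bool" where
  "strict_min_at g y t \<longleftrightarrow> (\<forall>z \<in> tangent_ball g y t. z \<noteq> y \<longrightarrow> g y < g z)"

lemma minimizer_iff:
  fixes g :: "real ^ 'n \<Rightarrow> real"
  assumes "C2 g" "0 \<le> t"
  shows "minimizer g x t y \<longleftrightarrow> y \<in> cball x t \<and> (\<forall>z \<in> cball x t. g y \<le> g z)"
proof -
  obtain y' where y': "norm (x - y') \<le> t" "hopf_lax g x t = g y'"
    "\<forall>z. norm (x - z) \<le> t \<longrightarrow> g y' \<le> g z"
    using hopf_lax_min[OF C2_continuous_on[OF assms(1)] assms(2)] by blast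
  then show ?thesis
    unfolding minimizer_def by (auto simp: dist_norm norm_minus_commute intro: antisym)
qed

lemma minimizer_exists:
  assumes "C2 g" "0 \<le> t" shows "\<exists>y. minimizer g x t y"
  using hopf_lax_min[OF C2_continuous_on[OF assms(1)] assms(2), of x]
  by (auto simp: minimizer_def norm_minus_commute)

lemma char_pt_grad_dir: "char_pt g y t = y + t *\<^sub>R grad_dir g y"
  by (simp add: char_pt_def grad_dir_def)

lemma norm_grad_dir: "grad g y \<noteq> 0 \<Longrightarrow> norm (grad_dir g y) = 1"
  by (simp add: grad_dir_def)

lemma norm_grad_dir_le: "norm (grad_dir g y) \<le> 1"
  by (cases "grad g y = 0") (simp_all add: grad_dir_def)

lemma inner_grad: "h \<bullet> grad g y = norm (grad g y) * (h \<bullet> grad_dir g y)"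
  by (cases "grad g y = 0") (simp_all add: grad_dir_def)

lemma tangent_ball_eq_cball:
  assumes "grad g y \<noteq> 0" "0 \<le> t"
  shows "tangent_ball g y t = cball (char_pt g y t) t"
proof -
  have "norm (z - (y + t *\<^sub>R grad_dir g y)) \<le> t \<longleftrightarrow> (norm (z - y))\<^sup>2 \<le> 2 * t * ((z - y) \<bullet> grad_dir g y)" for z
  proof -
    let ?h = "z - y" and ?v = "grad_dir g y"
    have "(norm (z - (y + t *\<^sub>R ?v)))\<^sup>2 = (norm (?h - t *\<^sub>R ?v))\<^sup>2" by (simp add: algebra_simps)
    also have "\<dots> = (norm ?h)\<^sup>2 - 2 * t * (?h \<bullet> ?v) + t\<^sup>2"
      using norm_grad_dir[OF assms(1)] unfolding power2_norm_eq_inner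
      by (simp add: inner_diff_left inner_diff_right inner_commute norm_eq_1 algebra_simps power2_eq_square)
    finally have "(norm (z - (y + t *\<^sub>R ?v)))\<^sup>2 \<le> t\<^sup>2 \<longleftrightarrow> (norm ?h)\<^sup>2 \<le> 2 * t * (?h \<bullet> ?v)"
      by linarith
    moreover have "(norm (z - (y + t *\<^sub>R ?v)))\<^sup>2 \<le> t\<^sup>2 \<longleftrightarrow> norm (z - (y + t *\<^sub>R ?v)) \<le> t"
      by (rule power_mono_iff) (use assms(2) in auto)
    ultimately show ?thesis by blast
  qed
  then show ?thesis
    unfolding tangent_ball_def char_pt_grad_dir cball_def dist_norm norm_minus_commute[of "y + t *\<^sub>R grad_dir g y"]
    by blast
qed

lemma self_in_tangent_ball [simp]: "y \<in> tangent_ball g y t"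
  by (simp add: tangent_ball_def)

lemma inner_grad_dir_pos:
  assumes "z \<in> tangent_ball g y t" "0 \<le> t" "z \<noteq> y"
  shows "0 < (z - y) \<bullet> grad_dir g y"
proof (rule ccontr)
  assume "\<not> ?thesis"
  then have "2 * t * ((z - y) \<bullet> grad_dir g y) \<le> 0"
    using assms(2) by (simp add: mult_nonneg_nonpos)
  then have "(norm (z - y))\<^sup>2 \<le> 0" using assms(1) unfolding tangent_ball_def mem_Collect_eq by linarith
  with assms(3) show False by simp
qed

text \<open>Away from \<open>y\<close>, each tangent ball lies in the interior of the larger ones, which is why a competitor
can be kept when the base point moves a little and the time grows a little.\<close>

lemma tangent_ball_strict_mono:
  assumes "z \<in> tangent_ball g y s" "0 \<le> s" "s < t" "z \<noteq> y"
  shows "(norm (z - y))\<^sup>2 < 2 * t * ((z - y) \<bullet> grad_dir g y)"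
proof -
  have "2 * s * ((z - y) \<bullet> grad_dir g y) < 2 * t * ((z - y) \<bullet> grad_dir g y)"
    using inner_grad_dir_pos[OF assms(1,2,4)] assms(3) by simp
  with assms(1) show ?thesis by (simp add: tangent_ball_def)
qed

lemma tangent_ball_mono:
  assumes "0 \<le> s" "s \<le> t" shows "tangent_ball g y s \<subseteq> tangent_ball g y t"
proof
  fix z assume z: "z \<in> tangent_ball g y s"
  show "z \<in> tangent_ball g y t"
  proof (cases "s = t \<or> z = y")
    case False
    with tangent_ball_strict_mono[OF z assms(1), of t] assms(2) show ?thesis
      by (auto simp: tangent_ball_def)
  qed (use z in auto)
qed

lemma min_at_mono: "\<lbrakk>min_at g y t; 0 \<le> s; s \<le> t\<rbrakk> \<Longrightarrow> min_at g y s"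
  using tangent_ball_mono[of s t g y] by (auto simp: min_at_def)

lemma strict_min_at_mono: "\<lbrakk>strict_min_at g y t; 0 \<le> s; s \<le> t\<rbrakk> \<Longrightarrow> strict_min_at g y s"
  using tangent_ball_mono[of s t g y] by (auto simp: strict_min_at_def)

lemma strict_min_imp_min: "strict_min_at g y t \<Longrightarrow> min_at g y t"
  unfolding strict_min_at_def min_at_def by (metis less_imp_le order_refl)

lemma minimizer_char_pt:
  assumes "C2 g" "grad g y \<noteq> 0" "0 \<le> t"
  shows "minimizer g (char_pt g y t) t y \<longleftrightarrow> min_at g y t"
  using minimizer_iff[OF assms(1,3)] self_in_tangent_ball[of y g t]
  unfolding min_at_def tangent_ball_eq_cball[OF assms(2,3)] by blast

lemma unique_minimizer_char_pt:
  assumes "C2 g" "grad g y \<noteq> 0" "0 \<le> t"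
  shows "unique_minimizer g (char_pt g y t) t y \<longleftrightarrow> strict_min_at g y t"
proof -
  have *: "minimizer g (char_pt g y t) t z \<longleftrightarrow> z \<in> tangent_ball g y t \<and> (\<forall>w \<in> tangent_ball g y t. g z \<le> g w)" for z
    using minimizer_iff[OF assms(1,3)] unfolding tangent_ball_eq_cball[OF assms(2,3)] by blast
  show ?thesis
    unfolding unique_minimizer_def strict_min_at_def *
    by (smt (verit, best) self_in_tangent_ball)
qed

text \<open>The homothety with centre \<open>y\<close> and factor \<open>k < 1\<close> maps the ball for time \<open>t\<close> into the ball for time
\<open>k * t\<close>; let \<open>k\<close> tend to 1.\<close>

lemma min_at_left_limit:
  assumes "C2 g" "0 < t" and below: "\<And>s. \<lbrakk>0 < s; s < t\<rbrakk> \<Longrightarrow> min_at g y s"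
  shows "min_at g y t"
  unfolding min_at_def
proof
  fix z assume z: "z \<in> tangent_ball g y t"
  let ?c = "\<lambda>k::real. y + k *\<^sub>R (z - y)"
  have "isCont g z"
    using has_derivative_continuous[OF C2_has_derivative[OF assms(1)]] .
  then have "((\<lambda>k. g (?c k)) \<longlongrightarrow> g (?c 1)) (at_left 1)"
    by (intro isCont_tendsto_compose[of _ g]) (auto intro!: tendsto_eq_intros)
  moreover have "\<forall>\<^sub>F k in at_left 1. g y \<le> g (?c k)"
  proof -
    have "g y \<le> g (?c k)" if k: "0 < k" "k < 1" for k
    proof -
      have "(norm (z - y))\<^sup>2 * k\<^sup>2 \<le> 2 * t * ((z - y) \<bullet> grad_dir g y) * k\<^sup>2"
        using z by (intro mult_right_mono) (auto simp: tangent_ball_def)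
      then have "?c k \<in> tangent_ball g y (k * t)"
        by (simp add: tangent_ball_def power_mult_distrib power2_eq_square mult_ac)
      with below[of "k * t"] k assms(2) show ?thesis by (simp add: min_at_def)
    qed
    then show ?thesis
      using eventually_at_left_real[of 0 "1::real"] by (auto elim!: eventually_mono)
  qed
  ultimately have "g y \<le> g (?c 1)"
    by (rule tendsto_lowerbound) simp
  then show "g y \<le> g z" by simp
qed

lemma norm_le_of_tangent_ball:
  assumes "z \<in> tangent_ball g y t" "0 \<le> t"
  shows "norm (z - y) \<le> 2 * t"
proof (cases "z = y")
  case False
  have "(z - y) \<bullet> grad_dir g y \<le> norm (z - y)"
    using Cauchy_Schwarz_ineq2[of "z - y" "grad_dir g y"] norm_grad_dir_le[of g y]
      mult_left_le[of "norm (grad_dir g y)" "norm (z - y)"] by simp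
  then have "2 * t * ((z - y) \<bullet> grad_dir g y) \<le> 2 * t * norm (z - y)"
    using assms(2) by (intro mult_left_mono) auto
  then have "norm (z - y) * norm (z - y) \<le> 2 * t * norm (z - y)"
    using assms(1) by (simp add: tangent_ball_def power2_eq_square)
  with False show ?thesis by simp
qed (use assms in simp)

text \<open>In a tangent ball of radius \<open>t\<close> the linear term of \<open>g\<close> is at least \<open>norm (grad g y) / (2 * t)\<close> times
the squared distance to \<open>y\<close>, which dominates a bounded Hessian once \<open>t\<close> is small.\<close>

lemma strict_min_at_small:
  fixes g :: "real ^ 'n \<Rightarrow> real"
  assumes "C2 g" and p: "grad g y \<noteq> 0"
  obtains t where "0 < t" "strict_min_at g y t"
proof -
  obtain H :: "real ^ 'n \<Rightarrow> (real ^ 'n) \<Rightarrow>\<^sub>L (real ^ 'n)" where H: "continuous_on UNIV H"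
    "\<And>y z. \<exists>x\<in>closed_segment y z.
        g z = g y + (z - y) \<bullet> grad g y + ((z - y) \<bullet> H x (z - y)) / 2"
    using C2_hessian[OF assms(1)] by blast
  have "compact (H ` cball y 1)"
    using H(1) by (intro compact_continuous_image) (auto intro: continuous_on_subset)
  then obtain K where K: "0 < K" "\<And>x. x \<in> cball y 1 \<Longrightarrow> norm (H x) \<le> K"
    using compact_imp_bounded[of "H ` cball y 1"] unfolding bounded_pos by blast
  \<comment> \<open>The bound \<open>1/2\<close> keeps the tangent ball inside \<open>cball y 1\<close>, where \<open>K\<close> bounds the Hessian.\<close>
  define t where "t = min (1/2) (norm (grad g y) / (2 * K))"
  have t: "0 < t" "2 * t \<le> 1" "K * t < norm (grad g y)"
  proof -
    show "0 < t" "2 * t \<le> 1" using p K by (auto simp: t_def)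
    have "K * t \<le> K * (norm (grad g y) / (2 * K))"
      using K by (intro mult_left_mono) (auto simp: t_def)
    also have "\<dots> = norm (grad g y) / 2" using K by simp
    finally show "K * t < norm (grad g y)" using p by (smt (verit) field_sum_of_halves norm_le_zero_iff)
  qed
  have "g y < g z" if z: "z \<in> tangent_ball g y t" "z \<noteq> y" for z
  proof -
    let ?h = "z - y"
    have "norm ?h \<le> 1" using norm_le_of_tangent_ball[OF z(1)] t by simp
    then have sub: "closed_segment y z \<subseteq> cball y 1"
      by (intro closed_segment_subset) (auto simp: dist_norm norm_minus_commute)
    obtain x where x: "x \<in> closed_segment y z" "g z = g y + ?h \<bullet> grad g y + (?h \<bullet> H x ?h) / 2"
      using H(2) by blast
    have "\<bar>?h \<bullet> H x ?h\<bar> \<le> norm ?h * norm (H x ?h)" by (rule Cauchy_Schwarz_ineq2)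
    also have "\<dots> \<le> norm ?h * (norm (H x) * norm ?h)"
      by (intro mult_left_mono norm_blinfun) auto
    also have "\<dots> \<le> norm ?h * (K * norm ?h)"
      using K(2) x(1) sub by (intro mult_left_mono mult_right_mono) auto
    finally have 1: "- (K * (norm ?h)\<^sup>2) \<le> ?h \<bullet> H x ?h"
      by (simp add: power2_eq_square mult_ac)
    have pos: "0 < ?h \<bullet> grad_dir g y" using inner_grad_dir_pos[OF z(1) _ z(2)] t by simp
    have "K * (norm ?h)\<^sup>2 \<le> K * (2 * t * (?h \<bullet> grad_dir g y))"
      using z(1) K by (intro mult_left_mono) (auto simp: tangent_ball_def)
    also have "\<dots> = 2 * ((K * t) * (?h \<bullet> grad_dir g y))" by simp
    also have "\<dots> < 2 * (norm (grad g y) * (?h \<bullet> grad_dir g y))"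
      using t(3) pos by simp
    finally have "K * (norm ?h)\<^sup>2 < 2 * (?h \<bullet> grad g y)" by (simp add: inner_grad)
    with 1 x(2) show ?thesis by simp
  qed
  then have "strict_min_at g y t" by (simp add: strict_min_at_def)
  with t(1) show thesis by (rule that)
qed

text \<open>The tangent balls exhaust the open half space \<open>H_half g y\<close>.\<close>

lemma E_set_iff:
  assumes "grad g y \<noteq> 0"
  shows "y \<in> E_set g \<longleftrightarrow> (\<exists>t>0. \<not> min_at g y t)"
proof
  assume "y \<in> E_set g"
  then obtain z where z: "0 < (z - y) \<bullet> grad g y" "g z < g y"
    by (auto simp: E_set_def H_half_def)
  let ?c = "(z - y) \<bullet> grad_dir g y"
  have c: "0 < ?c" using z(1) assms by (simp add: inner_grad zero_less_mult_iff)
  \<comment> \<open>The quotient is the time at which the tangent ball reaches \<open>z\<close>.\<close>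
  define t where "t = (norm (z - y))\<^sup>2 / (2 * ?c) + 1"
  have "0 < t" using c by (auto simp: t_def intro!: add_nonneg_pos)
  moreover have "z \<in> tangent_ball g y t"
    using c by (simp add: tangent_ball_def t_def field_simps)
  ultimately show "\<exists>t>0. \<not> min_at g y t"
    using z(2) by (meson min_at_def not_le)
next
  assume "\<exists>t>0. \<not> min_at g y t"
  then obtain t z where "0 < t" "z \<in> tangent_ball g y t" "g z < g y"
    by (auto simp: min_at_def not_le)
  moreover from this have "z \<noteq> y" by auto
  ultimately show "y \<in> E_set g"
    using inner_grad_dir_pos[of z g y t] assms
    by (auto simp: E_set_def H_half_def inner_grad intro!: exI[of _ z] bexI[of _ z])
qed

lemma tbar_s_le_iff:
  assumes "C2 g" "grad g y \<noteq> 0" "0 \<le> t"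
  shows "tbar_s g y \<le> ennreal t \<longleftrightarrow> (\<forall>\<tau>>t. \<not> strict_min_at g y \<tau>)"
proof -
  have "tbar_s g y \<le> ennreal t \<longleftrightarrow> (\<forall>\<tau>>0. strict_min_at g y \<tau> \<longrightarrow> \<tau> \<le> t)"
  proof -
    have "{ennreal \<tau> |\<tau>. 0 < \<tau> \<and> unique_minimizer g (char_pt g y \<tau>) \<tau> y} =
        ennreal ` {\<tau>. 0 < \<tau> \<and> strict_min_at g y \<tau>}"
      using unique_minimizer_char_pt[OF assms(1,2)] less_imp_le by blast
    then show ?thesis
      using assms(3) by (auto simp: tbar_s_def Sup_le_iff)
  qed
  also have "\<dots> \<longleftrightarrow> (\<forall>\<tau>>t. \<not> strict_min_at g y \<tau>)"
    using assms(3) by (meson not_le order_le_less_trans)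
  finally show ?thesis .
qed

lemma le_t_s_iff:
  assumes "C2 g" "grad g y \<noteq> 0" "0 < t"
  shows "ennreal t \<le> t_s g y \<longleftrightarrow> min_at g y t"
proof -
  have "ennreal t \<le> t_s g y \<longleftrightarrow> (\<forall>\<tau>>0. \<not> min_at g y \<tau> \<longrightarrow> t \<le> \<tau>)"
  proof -
    have "{ennreal \<tau> |\<tau>. 0 < \<tau> \<and> \<not> minimizer g (char_pt g y \<tau>) \<tau> y} =
        ennreal ` {\<tau>. 0 < \<tau> \<and> \<not> min_at g y \<tau>}"
      using minimizer_char_pt[OF assms(1,2)] less_imp_le by blast
    then show ?thesis by (auto simp: t_s_def le_Inf_iff)
  qed
  also have "\<dots> \<longleftrightarrow> min_at g y t"
  proof
    assume "\<forall>\<tau>>0. \<not> min_at g y \<tau> \<longrightarrow> t \<le> \<tau>"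
    then show "min_at g y t"
      using min_at_left_limit[OF assms(1,3)] not_le by metis
  next
    assume "min_at g y t"
    then show "\<forall>\<tau>>0. \<not> min_at g y \<tau> \<longrightarrow> t \<le> \<tau>"
      by (metis min_at_mono less_imp_le not_le)
  qed
  finally show ?thesis .
qed

lemma M_set_iff:
  assumes "C2 g"
  shows "y \<in> M_set g \<longleftrightarrow> grad g y \<noteq> 0 \<and> (\<exists>t>0. \<not> strict_min_at g y t)"
proof (cases "grad g y = 0")
  case False
  have "tbar_s g y < \<infinity> \<longleftrightarrow> (\<exists>t>0. \<not> strict_min_at g y t)"
  proof
    assume "tbar_s g y < \<infinity>"
    then obtain r where r: "0 \<le> r" "tbar_s g y = ennreal r"
      by (cases "tbar_s g y" rule: ennreal_cases) auto
    then have "\<not> strict_min_at g y (r + 1)" using tbar_s_le_iff[OF assms False r(1)] by simp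
    with r(1) show "\<exists>t>0. \<not> strict_min_at g y t" by (intro exI[of _ "r + 1"]) auto
  next
    assume "\<exists>t>0. \<not> strict_min_at g y t"
    then obtain t where t: "0 < t" "\<not> strict_min_at g y t" by blast
    then have "tbar_s g y \<le> ennreal t"
      using tbar_s_le_iff[OF assms False, of t] strict_min_at_mono[of g y _ t] by (meson less_imp_le)
    then show "tbar_s g y < \<infinity>" by (simp add: order_le_less_trans)
  qed
  with False show ?thesis by (simp add: M_set_def)
qed (simp add: M_set_def)

lemma E_subset_M: assumes "C2 g" shows "E_set g \<subseteq> M_set g"
proof
  fix y assume y: "y \<in> E_set g"
  then have p: "grad g y \<noteq> 0" by (simp add: E_set_def)
  with y E_set_iff[OF p] strict_min_imp_min[of g y] show "y \<in> M_set g"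
    unfolding M_set_iff[OF assms] by blast
qed

text \<open>The time \<open>t = 0\<close>, admitted in the definition of \<open>T_set\<close>, does not occur because \<open>y\<close> is a strict
minimum for small positive times.\<close>

lemma T_set_iff:
  assumes "C2 g" "S \<subseteq> M_set g"
  shows "(x, t) \<in> T_set g S \<longleftrightarrow>
    (\<exists>y\<in>S. x = char_pt g y t \<and> 0 < t \<and> min_at g y t \<and> (\<forall>\<tau>>t. \<not> strict_min_at g y \<tau>))"
proof -
  have "0 \<le> t \<and> tbar_s g y \<le> ennreal t \<and> ennreal t \<le> t_s g y \<longleftrightarrow>
      0 < t \<and> min_at g y t \<and> (\<forall>\<tau>>t. \<not> strict_min_at g y \<tau>)" if "y \<in> S" for y
  proof -
    have p: "grad g y \<noteq> 0" using that assms(2) by (auto simp: M_set_def)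
    obtain t0 where t0: "0 < t0" "strict_min_at g y t0" using strict_min_at_small[OF assms(1) p] .
    show ?thesis
      using tbar_s_le_iff[OF assms(1) p, of t] le_t_s_iff[OF assms(1) p, of t] t0
      by (metis less_eq_real_def)
  qed
  then show ?thesis unfolding T_set_def by blast
qed

text \<open>The real counterparts of the two extended thresholds. They are meaningful only where the set of
times is bounded, that is, on \<open>M_set g\<close> and on \<open>E_set g\<close> respectively.\<close>

definition last_strict_time :: "(real ^ 'n \<Rightarrow> real) \<Rightarrow> real ^ 'n \<Rightarrow> real" where
  "last_strict_time g y = Sup {t. 0 < t \<and> strict_min_at g y t}"

definition last_min_time :: "(real ^ 'n \<Rightarrow> real) \<Rightarrow> real ^ 'n \<Rightarrow> real" where
  "last_min_time g y = Sup {t. 0 < t \<and> min_at g y t}"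

text \<open>A property of positive reals that is inherited by smaller ones, holds somewhere and fails somewhere changes
at the supremum.\<close>

lemma threshold:
  fixes P :: "real \<Rightarrow> bool"
  assumes mono: "\<forall>s t. P t \<and> 0 < s \<and> s \<le> t \<longrightarrow> P s" and "0 < t0" "P t0" "0 < t1" "\<not> P t1"
  defines "c \<equiv> Sup {t. 0 < t \<and> P t}"
  shows "0 < c" "\<And>t. \<lbrakk>0 < t; t < c\<rbrakk> \<Longrightarrow> P t" "\<And>t. c < t \<Longrightarrow> \<not> P t"
proof -
  let ?S = "{t. 0 < t \<and> P t}"
  have ne: "?S \<noteq> {}" using assms by blast
  have bdd: "bdd_above ?S" using assms by (intro bdd_aboveI[of _ t1]) (metis mem_Collect_eq linear)
  show c: "0 < c" using cSup_upper[OF _ bdd, of t0] assms by auto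
  show "P t" if "0 < t" "t < c" for t
    using less_cSup_iff[OF ne bdd] that mono less_imp_le unfolding c_def by (metis (lifting) mem_Collect_eq)
  show "\<not> P t" if "c < t" for t
    using cSup_upper[OF _ bdd, of t] that c unfolding c_def by force
qed

lemma last_strict_time:
  assumes "C2 g" "y \<in> M_set g"
  shows "0 < last_strict_time g y" "\<And>t. \<lbrakk>0 < t; t < last_strict_time g y\<rbrakk> \<Longrightarrow> strict_min_at g y t"
    "\<And>t. last_strict_time g y < t \<Longrightarrow> \<not> strict_min_at g y t" "min_at g y (last_strict_time g y)"
proof -
  have p: "grad g y \<noteq> 0" using assms(2) by (simp add: M_set_def)
  obtain t0 where t0: "0 < t0" "strict_min_at g y t0" using strict_min_at_small[OF assms(1) p] .
  obtain t1 where t1: "0 < t1" "\<not> strict_min_at g y t1" using assms M_set_iff by blast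
  have mono: "\<forall>s t. strict_min_at g y t \<and> 0 < s \<and> s \<le> t \<longrightarrow> strict_min_at g y s"
    using strict_min_at_mono less_imp_le by blast
  note th = threshold[of "strict_min_at g y", OF mono t0 t1, folded last_strict_time_def]
  show "0 < last_strict_time g y" by (rule th(1))
  show below: "strict_min_at g y t" if "0 < t" "t < last_strict_time g y" for t by (rule th(2)[OF that])
  show "\<not> strict_min_at g y t" if "last_strict_time g y < t" for t by (rule th(3)[OF that])
  show "min_at g y (last_strict_time g y)"
    by (rule min_at_left_limit[OF assms(1) th(1)]) (rule strict_min_imp_min, rule below)
qed

lemma last_min_time:
  assumes "C2 g" "y \<in> E_set g"
  shows "0 < last_min_time g y" "\<And>t. \<lbrakk>0 < t; t < last_min_time g y\<rbrakk> \<Longrightarrow> min_at g y t"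
    "\<And>t. last_min_time g y < t \<Longrightarrow> \<not> min_at g y t" "min_at g y (last_min_time g y)" "last_strict_time g y \<le> last_min_time g y"
proof -
  have p: "grad g y \<noteq> 0" using assms(2) by (simp add: E_set_def)
  have M: "y \<in> M_set g" using E_subset_M assms by blast
  obtain t1 where t1: "0 < t1" "\<not> min_at g y t1" using assms(2) E_set_iff[OF p] by blast
  have mono: "\<forall>s t. min_at g y t \<and> 0 < s \<and> s \<le> t \<longrightarrow> min_at g y s"
    using min_at_mono less_imp_le by blast
  note th = threshold[of "min_at g y", OF mono last_strict_time(1)[OF assms(1) M]
    last_strict_time(4)[OF assms(1) M] t1, folded last_min_time_def]
  show "0 < last_min_time g y" by (rule th(1))
  show below: "min_at g y t" if "0 < t" "t < last_min_time g y" for t by (rule th(2)[OF that])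
  show above: "\<not> min_at g y t" if "last_min_time g y < t" for t by (rule th(3)[OF that])
  show "min_at g y (last_min_time g y)"
    by (rule min_at_left_limit[OF assms(1) th(1)]) (rule below)
  show "last_strict_time g y \<le> last_min_time g y" using above[of "last_strict_time g y"] last_strict_time(4)[OF assms(1) M] by fastforce
qed

lemma fibre_iff:
  assumes "C2 g" "y \<in> M_set g"
  shows "(0 < t \<and> min_at g y t \<and> (\<forall>\<tau>>t. \<not> strict_min_at g y \<tau>)) \<longleftrightarrow> last_strict_time g y \<le> t \<and> min_at g y t"
proof -
  have "(\<forall>\<tau>>t. \<not> strict_min_at g y \<tau>) \<longleftrightarrow> last_strict_time g y \<le> t" if "0 < t"
  proof
    assume *: "\<forall>\<tau>>t. \<not> strict_min_at g y \<tau>"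
    show "last_strict_time g y \<le> t"
    proof (rule ccontr)
      assume "\<not> last_strict_time g y \<le> t"
      then obtain \<tau> where "t < \<tau>" "\<tau> < last_strict_time g y" using dense[of t "last_strict_time g y"] by (auto simp: not_le)
      then show False using * last_strict_time(2)[OF assms, of \<tau>] that by auto
    qed
  next
    assume "last_strict_time g y \<le> t"
    then show "\<forall>\<tau>>t. \<not> strict_min_at g y \<tau>" using last_strict_time(3)[OF assms] by auto
  qed
  then show ?thesis using last_strict_time(1)[OF assms] by auto
qed

section \<open>One-sided semicontinuity of the threshold times\<close>

lemma tendsto_closed_segment:
  fixes l :: "'a::real_normed_vector"
  assumes "a \<longlonglongrightarrow> l" "b \<longlonglongrightarrow> l" "\<And>n. x n \<in> closed_segment (a n) (b n)"
  shows "x \<longlonglongrightarrow> l"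
proof -
  have "(\<lambda>n. x n - a n) \<longlonglongrightarrow> 0"
  proof (rule Lim_null_comparison)
    show "\<forall>\<^sub>F n in sequentially. norm (x n - a n) \<le> norm (b n - a n)"
      using segment_bound(1)[OF assms(3)] by simp
    show "(\<lambda>n. norm (b n - a n)) \<longlonglongrightarrow> 0"
      using tendsto_norm[OF tendsto_diff[OF assms(2,1)]] by simp
  qed
  from tendsto_add[OF this assms(1)] show ?thesis by simp
qed

lemma eventually_nhds_sequenceI:
  fixes a :: "'a::metric_space"
  assumes "\<And>x. \<lbrakk>x \<longlonglongrightarrow> a; \<And>n. \<not> P (x n)\<rbrakk> \<Longrightarrow> False"
  shows "\<forall>\<^sub>F x in nhds a. P x"
proof (rule ccontr)
  assume "\<not> ?thesis"
  then have "\<exists>x. dist x a < inverse (Suc n) \<and> \<not> P x" for n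
    unfolding eventually_nhds_metric by (meson inverse_positive_iff_positive of_nat_0_less_iff zero_less_Suc)
  then obtain x where x: "\<And>n. dist (x n) a < inverse (Suc n)" "\<And>n. \<not> P (x n)" by metis
  have "x \<longlonglongrightarrow> a"
    unfolding tendsto_dist_iff[of x]
    by (rule tendsto_sandwich[OF _ _ tendsto_const LIMSEQ_inverse_real_of_nat])
       (use x(1) in \<open>auto intro!: always_eventually simp: less_imp_le simp del: of_nat_Suc\<close>)
  then show False using assms x(2) by blast
qed

lemma continuous_on_grad_dir:
  assumes "C2 g" "\<And>y. y \<in> S \<Longrightarrow> grad g y \<noteq> 0" shows "continuous_on S (grad_dir g)"
  unfolding grad_dir_def using assms(2)
  by (intro continuous_intros C2_continuous_on_grad[OF assms(1)]) auto

lemma C2_tendsto_grad: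
  assumes "C2 g" "(f \<longlongrightarrow> y) F" shows "((\<lambda>x. grad g (f x)) \<longlongrightarrow> grad g y) F"
  using continuous_on_tendsto_compose[OF C2_continuous_on_grad[OF assms(1), of UNIV] assms(2)] by simp

lemma C2_tendsto:
  assumes "C2 g" "(f \<longlongrightarrow> y) F" shows "((\<lambda>x. g (f x)) \<longlongrightarrow> g y) F"
  using continuous_on_tendsto_compose[OF C2_continuous_on[OF assms(1), of UNIV] assms(2)] by simp

lemma C2_tendsto_grad_dir:
  assumes "C2 g" "grad g y \<noteq> 0" "(f \<longlongrightarrow> y) F" shows "((\<lambda>x. grad_dir g (f x)) \<longlongrightarrow> grad_dir g y) F"
  unfolding grad_dir_def using assms(2)
  by (intro tendsto_intros C2_tendsto_grad[OF assms(1,3)]) auto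

text \<open>Second-order necessary condition: a level set that stays outside the ball of radius \<open>T\<close> has curvature at most
\<open>1 / T\<close> at the point of contact. It is tested along the parabola
\<open>y + e *\<^sub>R w + (e\<^sup>2 / (2 * t)) *\<^sub>R grad_dir g y\<close>, which enters the tangent ball of radius \<open>T\<close>
because \<open>t < T\<close>.\<close>

lemma tangential_hessian_bound:
  fixes g :: "real ^ 'n \<Rightarrow> real" and H :: "real ^ 'n \<Rightarrow> (real ^ 'n) \<Rightarrow>\<^sub>L (real ^ 'n)"
  assumes H: "continuous_on UNIV H"
    "\<And>y z. \<exists>x\<in>closed_segment y z.
        g z = g y + (z - y) \<bullet> grad g y + ((z - y) \<bullet> H x (z - y)) / 2"
    and p: "grad g y \<noteq> 0" and T: "min_at g y T" "0 < t" "t < T"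
    and w: "norm w = 1" "w \<bullet> grad_dir g y = 0"
  shows "0 \<le> norm (grad g y) / t + w \<bullet> H y w"
proof -
  let ?v = "grad_dir g y" and ?p = "norm (grad g y)"
  define e where "e = (\<lambda>n. inverse (real (Suc n)))"
  define k where "k = (\<lambda>n. w + (e n / (2 * t)) *\<^sub>R ?v)"
  define z where "z = (\<lambda>n. y + e n *\<^sub>R k n)"
  have e_pos: "0 < e n" for n by (simp add: e_def)
  have e_lim: "e \<longlonglongrightarrow> 0" unfolding e_def by (rule LIMSEQ_inverse_real_of_nat)
  have k_lim: "k \<longlonglongrightarrow> w"
    unfolding k_def using T(2) by (auto intro!: tendsto_eq_intros e_lim)
  have z_lim: "z \<longlonglongrightarrow> y"
    unfolding z_def by (auto intro!: tendsto_eq_intros e_lim k_lim)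
  have "\<forall>n. \<exists>x. x \<in> closed_segment y (z n) \<and>
      g (z n) = g y + (z n - y) \<bullet> grad g y + ((z n - y) \<bullet> H x (z n - y)) / 2"
    using H(2) by blast
  from choice[OF this] obtain x where x: "\<And>n. x n \<in> closed_segment y (z n)"
    "\<And>n. g (z n) = g y + (z n - y) \<bullet> grad g y + ((z n - y) \<bullet> H (x n) (z n - y)) / 2"
    by blast
  have x_lim: "x \<longlonglongrightarrow> y"
    by (rule tendsto_closed_segment[OF tendsto_const z_lim x(1)])
  have vv: "?v \<bullet> ?v = 1" using norm_grad_dir[OF p] by (simp add: norm_eq_1)
  have kv: "k n \<bullet> ?v = e n / (2 * t)" for n
    using w vv by (simp add: k_def inner_add_left)
  have kk: "(norm (k n))\<^sup>2 = 1 + (e n / (2 * t))\<^sup>2" for n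
    using w vv unfolding power2_norm_eq_inner
    by (simp add: k_def inner_add_left inner_add_right inner_commute norm_eq_1 power2_eq_square)
  have "(\<lambda>n. 1 + (e n / (2 * t))\<^sup>2) \<longlonglongrightarrow> 1"
    using T(2) by (auto intro!: tendsto_eq_intros e_lim)
  then have "\<forall>\<^sub>F n in sequentially. 1 + (e n / (2 * t))\<^sup>2 < T / t"
    by (rule order_tendstoD) (use T in simp)
  then have ev: "\<forall>\<^sub>F n in sequentially. 0 \<le> ?p / t + k n \<bullet> H (x n) (k n)"
  proof eventually_elim
    case (elim n)
    have "(norm (z n - y))\<^sup>2 = (e n)\<^sup>2 * (1 + (e n / (2 * t))\<^sup>2)"
      by (simp add: z_def power_mult_distrib kk)
    also have "\<dots> \<le> (e n)\<^sup>2 * (T / t)"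
      using elim by (intro mult_left_mono) auto
    also have "\<dots> = 2 * T * ((z n - y) \<bullet> ?v)"
      by (simp add: z_def kv power2_eq_square)
    finally have "z n \<in> tangent_ball g y T" by (simp add: tangent_ball_def)
    then have "g y \<le> g (z n)" using T(1) by (simp add: min_at_def)
    then have "0 \<le> (z n - y) \<bullet> grad g y + ((z n - y) \<bullet> H (x n) (z n - y)) / 2"
      using x(2)[of n] by simp
    also have "\<dots> = (e n)\<^sup>2 / 2 * (?p / t + k n \<bullet> H (x n) (k n))"
      by (simp add: z_def inner_grad kv blinfun.scaleR_right power2_eq_square algebra_simps)
    finally show ?case
      using e_pos[of n] by (simp add: zero_le_mult_iff)
  qed
  have "(\<lambda>n. H (x n)) \<longlonglongrightarrow> H y"
    using continuous_on_tendsto_compose[OF H(1) x_lim] by simp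
  then have "(\<lambda>n. ?p / t + k n \<bullet> H (x n) (k n)) \<longlonglongrightarrow> ?p / t + w \<bullet> H y w"
    by (intro tendsto_intros blinfun.tendsto k_lim)
  then show ?thesis
    by (rule tendsto_lowerbound[OF _ ev]) simp
qed

text \<open>If competitors for time \<open>t\<close> collapsed onto \<open>y0\<close>, the limit \<open>w0\<close> of their directions would be
tangential, and Taylor's formula would give \<open>norm (grad g y0) / t \<le> - (w0 \<bullet> H y0 w0)\<close>. Since \<open>y0\<close> is minimal up
to the later time \<open>T\<close>, this contradicts \<open>tangential_hessian_bound\<close>.\<close>

lemma no_competitors_near:
  fixes g :: "real ^ 'n \<Rightarrow> real"
  assumes g: "C2 g" and p: "grad g y0 \<noteq> 0" and T: "min_at g y0 T" "0 < t" "t < T"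
    and y: "y \<longlonglongrightarrow> y0" and z: "z \<longlonglongrightarrow> y0"
    and comp: "\<And>n. z n \<noteq> y n" "\<And>n. z n \<in> tangent_ball g (y n) t" "\<And>n. g (z n) \<le> g (y n)"
  shows False
proof -
  obtain H :: "real ^ 'n \<Rightarrow> (real ^ 'n) \<Rightarrow>\<^sub>L (real ^ 'n)" where H: "continuous_on UNIV H"
    "\<And>y z. \<exists>x\<in>closed_segment y z.
        g z = g y + (z - y) \<bullet> grad g y + ((z - y) \<bullet> H x (z - y)) / 2"
    using C2_hessian[OF g] by blast
  define h where "h = (\<lambda>n. z n - y n)"
  define w where "w = (\<lambda>n. h n /\<^sub>R norm (h n))"
  let ?p = "norm (grad g y0)"
  have h_pos: "0 < norm (h n)" for n using comp(1) by (simp add: h_def)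
  have "w n \<in> sphere 0 1" for n using h_pos[of n] by (simp add: w_def)
  then obtain w0 \<sigma> where w0: "w0 \<in> sphere 0 1" "strict_mono (\<sigma> :: nat \<Rightarrow> nat)" "(w \<circ> \<sigma>) \<longlonglongrightarrow> w0"
    using compact_sphere[of "0::real^'n" 1] unfolding compact_def by meson
  have "\<forall>n. \<exists>x. x \<in> closed_segment (y n) (z n) \<and>
      g (z n) = g (y n) + (z n - y n) \<bullet> grad g (y n) + ((z n - y n) \<bullet> H x (z n - y n)) / 2"
    using H(2) by blast
  from choice[OF this] obtain x where x: "\<And>n. x n \<in> closed_segment (y n) (z n)"
    "\<And>n. g (z n) = g (y n) + (z n - y n) \<bullet> grad g (y n) + ((z n - y n) \<bullet> H (x n) (z n - y n)) / 2"
    by blast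
  have h_eq: "h n = norm (h n) *\<^sub>R w n" for n using h_pos[of n] by (simp add: w_def)
  have up: "norm (grad g (y n)) * (w n \<bullet> grad_dir g (y n)) \<le> - norm (h n) / 2 * (w n \<bullet> H (x n) (w n))" for n
  proof -
    have "h n \<bullet> grad g (y n) + (h n \<bullet> H (x n) (h n)) / 2 \<le> 0"
      using x(2)[of n] comp(3)[of n] by (simp add: h_def)
    also have "h n \<bullet> grad g (y n) + (h n \<bullet> H (x n) (h n)) / 2 =
        norm (h n) * (norm (grad g (y n)) * (w n \<bullet> grad_dir g (y n)) + norm (h n) / 2 * (w n \<bullet> H (x n) (w n)))"
      by (subst (1 2 3) h_eq) (simp add: inner_grad blinfun.scaleR_right algebra_simps)
    finally show ?thesis using h_pos[of n] by (simp add: mult_le_0_iff)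
  qed
  have low: "norm (h n) \<le> 2 * t * (w n \<bullet> grad_dir g (y n))" for n
  proof -
    have "norm (h n) * norm (h n) \<le> 2 * t * (h n \<bullet> grad_dir g (y n))"
      using comp(2)[of n] by (simp add: tangent_ball_def h_def power2_eq_square)
    also have "\<dots> = norm (h n) * (2 * t * (w n \<bullet> grad_dir g (y n)))"
      by (subst h_eq) simp
    finally show ?thesis using h_pos[of n] by simp
  qed
  have both: "norm (grad g (y n)) / t \<le> - (w n \<bullet> H (x n) (w n))" for n
  proof -
    have "norm (grad g (y n)) * norm (h n) \<le> norm (grad g (y n)) * (2 * t * (w n \<bullet> grad_dir g (y n)))"
      by (rule mult_left_mono[OF low]) simp
    also have "\<dots> = 2 * t * (norm (grad g (y n)) * (w n \<bullet> grad_dir g (y n)))" by simp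
    also have "\<dots> \<le> 2 * t * (- norm (h n) / 2 * (w n \<bullet> H (x n) (w n)))"
      by (rule mult_left_mono[OF up]) (use T in simp)
    also have "\<dots> = (- t * (w n \<bullet> H (x n) (w n))) * norm (h n)" by simp
    finally have "norm (grad g (y n)) \<le> - t * (w n \<bullet> H (x n) (w n))"
      using h_pos[of n] by (simp only: mult_le_cancel_right_pos)
    then show ?thesis using T by (simp add: field_simps)
  qed
  have y': "(\<lambda>n. y (\<sigma> n)) \<longlonglongrightarrow> y0" and z': "(\<lambda>n. z (\<sigma> n)) \<longlonglongrightarrow> y0" and w': "(\<lambda>n. w (\<sigma> n)) \<longlonglongrightarrow> w0"
    using LIMSEQ_subseq_LIMSEQ[OF y w0(2)] LIMSEQ_subseq_LIMSEQ[OF z w0(2)] w0(3) by (simp_all add: o_def)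
  have h': "(\<lambda>n. h (\<sigma> n)) \<longlonglongrightarrow> 0"
    using tendsto_diff[OF z' y'] by (simp add: h_def)
  have x': "(\<lambda>n. x (\<sigma> n)) \<longlonglongrightarrow> y0"
    by (rule tendsto_closed_segment[OF y' z' x(1)])
  have "(\<lambda>n. H (x (\<sigma> n))) \<longlonglongrightarrow> H y0"
    using continuous_on_tendsto_compose[OF H(1) x'] by simp
  then have Hw: "(\<lambda>n. w (\<sigma> n) \<bullet> H (x (\<sigma> n)) (w (\<sigma> n))) \<longlonglongrightarrow> w0 \<bullet> H y0 w0"
    by (rule tendsto_inner[OF w' blinfun.tendsto[OF _ w']])
  have gy: "(\<lambda>n. grad g (y (\<sigma> n))) \<longlonglongrightarrow> grad g y0" by (rule C2_tendsto_grad[OF g y'])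
  have dy: "(\<lambda>n. grad_dir g (y (\<sigma> n))) \<longlonglongrightarrow> grad_dir g y0" by (rule C2_tendsto_grad_dir[OF g p y'])
  have perp: "w0 \<bullet> grad_dir g y0 = 0"
  proof (rule antisym)
    have "?p * (w0 \<bullet> grad_dir g y0) \<le> - norm (0::real^'n) / 2 * (w0 \<bullet> H y0 w0)"
    proof (rule LIMSEQ_le)
      show "(\<lambda>n. norm (grad g (y (\<sigma> n))) * (w (\<sigma> n) \<bullet> grad_dir g (y (\<sigma> n)))) \<longlonglongrightarrow> ?p * (w0 \<bullet> grad_dir g y0)"
        by (intro tendsto_intros gy dy w')
      show "(\<lambda>n. - norm (h (\<sigma> n)) / 2 * (w (\<sigma> n) \<bullet> H (x (\<sigma> n)) (w (\<sigma> n)))) \<longlonglongrightarrow>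
          - norm (0::real^'n) / 2 * (w0 \<bullet> H y0 w0)"
        by (rule tendsto_mult[OF tendsto_divide[OF tendsto_minus[OF tendsto_norm[OF h']] tendsto_const] Hw])
           simp
    qed (use up in blast)
    then show "w0 \<bullet> grad_dir g y0 \<le> 0" using p by (simp add: mult_le_0_iff)
    have "0 \<le> w n \<bullet> grad_dir g (y n)" for n
      using low[of n] h_pos[of n] T by (smt (verit) zero_less_mult_iff)
    then show "0 \<le> w0 \<bullet> grad_dir g y0"
      by (intro LIMSEQ_le_const[OF tendsto_inner[OF w' dy]]) auto
  qed
  have "?p / t \<le> - (w0 \<bullet> H y0 w0)"
  proof (rule LIMSEQ_le)
    show "(\<lambda>n. norm (grad g (y (\<sigma> n))) / t) \<longlonglongrightarrow> ?p / t"
      using T by (intro tendsto_intros gy) auto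
    show "(\<lambda>n. - (w (\<sigma> n) \<bullet> H (x (\<sigma> n)) (w (\<sigma> n)))) \<longlonglongrightarrow> - (w0 \<bullet> H y0 w0)"
      by (rule tendsto_minus[OF Hw])
  qed (use both in blast)
  moreover have "0 \<le> ?p / ((t + T) / 2) + w0 \<bullet> H y0 w0"
    by (rule tangential_hessian_bound[OF H p T(1)]) (use T w0 perp in auto)
  ultimately have "?p / t \<le> ?p / ((t + T) / 2)" by simp
  moreover have "?p / ((t + T) / 2) < ?p / t"
    using p T by (intro divide_strict_left_mono) auto
  ultimately show False by simp
qed

text \<open>The competitors stay in bounded balls, so they have an accumulation point; \<open>no_competitors_near\<close> excludes
\<open>y0\<close>, and the other properties pass to the limit.\<close>

lemma competitors_accumulate_elsewhere:
  fixes g :: "real ^ 'n \<Rightarrow> real"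
  assumes g: "C2 g" and p: "grad g y0 \<noteq> 0" and T: "min_at g y0 T" "0 < t" "t < T"
    and y: "y \<longlonglongrightarrow> y0"
    and comp: "\<And>n. z n \<noteq> y n" "\<And>n. z n \<in> tangent_ball g (y n) t" "\<And>n. g (z n) \<le> g (y n)"
  obtains z0 \<sigma> where "strict_mono (\<sigma> :: nat \<Rightarrow> nat)" "(\<lambda>n. z (\<sigma> n)) \<longlonglongrightarrow> z0" "z0 \<noteq> y0"
    "z0 \<in> tangent_ball g y0 t" "g z0 \<le> g y0"
proof -
  obtain B where B: "\<And>n. norm (y n) \<le> B"
    using convergent_imp_bounded[OF y] by (auto simp: bounded_iff)
  have "norm (z n) \<le> B + 2 * t" for n
    using norm_le_of_tangent_ball[OF comp(2)[of n]] T B[of n] norm_triangle_sub[of "z n" "y n"] by simp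
  then have "bounded (range z)" by (auto simp: bounded_iff)
  then obtain z0 \<sigma> where \<sigma>: "strict_mono (\<sigma> :: nat \<Rightarrow> nat)" "(z \<circ> \<sigma>) \<longlonglongrightarrow> z0"
    using bounded_imp_convergent_subsequence[of z] by blast
  have z': "(\<lambda>n. z (\<sigma> n)) \<longlonglongrightarrow> z0" and y': "(\<lambda>n. y (\<sigma> n)) \<longlonglongrightarrow> y0"
    using \<sigma>(2) LIMSEQ_subseq_LIMSEQ[OF y \<sigma>(1)] by (simp_all add: o_def)
  show thesis
  proof (rule that[OF \<sigma>(1) z'])
    show "z0 \<noteq> y0"
      using no_competitors_near[OF g p T y', of "\<lambda>n. z (\<sigma> n)"] comp z' by blast
    have "(norm (z0 - y0))\<^sup>2 \<le> 2 * t * ((z0 - y0) \<bullet> grad_dir g y0)"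
    proof (rule LIMSEQ_le)
      show "(\<lambda>n. (norm (z (\<sigma> n) - y (\<sigma> n)))\<^sup>2) \<longlonglongrightarrow> (norm (z0 - y0))\<^sup>2"
        by (intro tendsto_intros z' y')
      show "(\<lambda>n. 2 * t * ((z (\<sigma> n) - y (\<sigma> n)) \<bullet> grad_dir g (y (\<sigma> n)))) \<longlonglongrightarrow>
          2 * t * ((z0 - y0) \<bullet> grad_dir g y0)"
        by (intro tendsto_intros z' y' C2_tendsto_grad_dir[OF g p])
    qed (use comp(2) in \<open>auto simp: tangent_ball_def\<close>)
    then show "z0 \<in> tangent_ball g y0 t" by (simp add: tangent_ball_def)
    show "g z0 \<le> g y0"
      by (rule LIMSEQ_le[OF C2_tendsto[OF g z'] C2_tendsto[OF g y']]) (use comp(3) in blast)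
  qed
qed

text \<open>Lower semicontinuity of the last time of strict minimality: a limit of competitors would be a competitor of
\<open>y0\<close> different from \<open>y0\<close>.\<close>

lemma strict_min_at_stable:
  assumes g: "C2 g" and p: "grad g y0 \<noteq> 0" and T: "strict_min_at g y0 T" "0 < t" "t < T"
  shows "\<forall>\<^sub>F y in nhds y0. strict_min_at g y t"
proof (rule eventually_nhds_sequenceI)
  fix y assume y: "y \<longlonglongrightarrow> y0" and "\<And>n. \<not> strict_min_at g (y n) t"
  then obtain z where z: "\<And>n. z n \<in> tangent_ball g (y n) t" "\<And>n. z n \<noteq> y n" "\<And>n. g (z n) \<le> g (y n)"
    unfolding strict_min_at_def not_less[symmetric] by metis
  obtain z0 where "z0 \<noteq> y0" "z0 \<in> tangent_ball g y0 t" "g z0 \<le> g y0"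
    using competitors_accumulate_elsewhere[OF g p strict_min_imp_min[OF T(1)] T(2,3) y z(2,1,3)] by blast
  then show False
    using strict_min_at_mono[OF T(1), of t] T by (auto simp: strict_min_at_def)
qed

lemma eventually_in_tangent_ball:
  assumes g: "C2 g" and p: "grad g y0 \<noteq> 0" and "(norm (z - y0))\<^sup>2 < 2 * t * ((z - y0) \<bullet> grad_dir g y0)"
  shows "\<forall>\<^sub>F y in nhds y0. z \<in> tangent_ball g y t"
proof -
  have id: "((\<lambda>y. y) \<longlongrightarrow> y0) (nhds y0)" by (rule filterlim_ident)
  have "((\<lambda>y. 2 * t * ((z - y) \<bullet> grad_dir g y) - (norm (z - y))\<^sup>2) \<longlongrightarrow>
      2 * t * ((z - y0) \<bullet> grad_dir g y0) - (norm (z - y0))\<^sup>2) (nhds y0)"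
    by (intro tendsto_intros id C2_tendsto_grad_dir[OF g p])
  then have "\<forall>\<^sub>F y in nhds y0. 0 < 2 * t * ((z - y) \<bullet> grad_dir g y) - (norm (z - y))\<^sup>2"
    by (rule order_tendstoD) (use assms(3) in simp)
  then show ?thesis by eventually_elim (simp add: tangent_ball_def)
qed

text \<open>Competitors of points \<open>y\<close> below the level of \<open>y0\<close> are strictly below that level too. Their limit lies in the interior
of the larger ball for time \<open>T\<close>, so some of them lie in that ball and beat \<open>y0\<close>.\<close>

lemma strict_min_at_below_level:
  assumes g: "C2 g" and p: "grad g y0 \<noteq> 0" and T: "min_at g y0 T" "0 < t" "t < T"
  shows "\<forall>\<^sub>F y in nhds y0. g y < g y0 \<longrightarrow> strict_min_at g y t"
proof (rule eventually_nhds_sequenceI)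
  fix y assume y: "y \<longlonglongrightarrow> y0" and "\<And>n. \<not> (g (y n) < g y0 \<longrightarrow> strict_min_at g (y n) t)"
  then have below: "\<And>n. g (y n) < g y0" and "\<And>n. \<not> strict_min_at g (y n) t" by auto
  then obtain z where z: "\<And>n. z n \<in> tangent_ball g (y n) t" "\<And>n. z n \<noteq> y n" "\<And>n. g (z n) \<le> g (y n)"
    unfolding strict_min_at_def not_less[symmetric] by metis
  obtain z0 \<sigma> where z0: "(\<lambda>n. z (\<sigma> n :: nat)) \<longlonglongrightarrow> z0" "z0 \<noteq> y0" "z0 \<in> tangent_ball g y0 t"
    using competitors_accumulate_elsewhere[OF g p T y z(2,1,3)] by blast
  have "(\<lambda>n. 2 * T * ((z (\<sigma> n) - y0) \<bullet> grad_dir g y0) - (norm (z (\<sigma> n) - y0))\<^sup>2) \<longlonglongrightarrow>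
      2 * T * ((z0 - y0) \<bullet> grad_dir g y0) - (norm (z0 - y0))\<^sup>2"
    by (intro tendsto_intros z0)
  then have "\<forall>\<^sub>F n in sequentially. 0 < 2 * T * ((z (\<sigma> n) - y0) \<bullet> grad_dir g y0) - (norm (z (\<sigma> n) - y0))\<^sup>2"
    by (rule order_tendstoD) (use tangent_ball_strict_mono[OF z0(3) _ T(3) z0(2)] T in simp)
  then obtain n where "0 < 2 * T * ((z (\<sigma> n) - y0) \<bullet> grad_dir g y0) - (norm (z (\<sigma> n) - y0))\<^sup>2"
    by (auto simp: eventually_sequentially)
  then have "g y0 \<le> g (z (\<sigma> n))" using T(1) by (simp add: min_at_def tangent_ball_def)
  then show False using z(3)[of "\<sigma> n"] below[of "\<sigma> n"] by simp
qed

text \<open>A competitor of \<open>y0\<close>, at most at its level, lies inside the tangent balls of all nearby points and beats those at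
higher levels.\<close>

lemma not_min_at_above_level:
  assumes g: "C2 g" and M: "y0 \<in> M_set g" and t: "last_strict_time g y0 < t"
  shows "\<forall>\<^sub>F y in nhds y0. g y0 < g y \<longrightarrow> \<not> min_at g y t"
proof -
  have p: "grad g y0 \<noteq> 0" using M by (simp add: M_set_def)
  obtain s where s: "last_strict_time g y0 < s" "s < t" using dense[OF t] by blast
  then obtain z where z: "z \<in> tangent_ball g y0 s" "z \<noteq> y0" "g z \<le> g y0"
    using last_strict_time(3)[OF g M, of s] by (auto simp: strict_min_at_def not_less)
  have "0 < s" using s last_strict_time(1)[OF g M] by simp
  have "\<forall>\<^sub>F y in nhds y0. z \<in> tangent_ball g y t"
    by (rule eventually_in_tangent_ball[OF g p tangent_ball_strict_mono[OF z(1) _ s(2) z(2)]]) (use \<open>0 < s\<close> in simp)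
  then show ?thesis
    by eventually_elim (use z in \<open>force simp: min_at_def\<close>)
qed

lemma not_min_at_stable:
  assumes g: "C2 g" and E: "y0 \<in> E_set g" and t: "last_min_time g y0 < t"
  shows "\<forall>\<^sub>F y in nhds y0. \<not> min_at g y t"
proof -
  have p: "grad g y0 \<noteq> 0" using E by (simp add: E_set_def)
  obtain s where s: "last_min_time g y0 < s" "s < t" using dense[OF t] by blast
  then obtain z where z: "z \<in> tangent_ball g y0 s" "g z < g y0"
    using last_min_time(3)[OF g E, of s] by (auto simp: min_at_def not_le)
  then have "z \<noteq> y0" by auto
  have "0 < s" using s last_min_time(1)[OF g E] by simp
  have "\<forall>\<^sub>F y in nhds y0. z \<in> tangent_ball g y t"
    by (rule eventually_in_tangent_ball[OF g p tangent_ball_strict_mono[OF z(1) _ s(2) \<open>z \<noteq> y0\<close>]]) (use \<open>0 < s\<close> in simp)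
  moreover have "\<forall>\<^sub>F y in nhds y0. g z < g y"
    by (rule order_tendstoD[OF C2_tendsto[OF g filterlim_ident] z(2)])
  ultimately show ?thesis
    by eventually_elim (force simp: min_at_def)
qed

section \<open>The singular points are the points of T(M)\<close>

text \<open>The first-order condition in the direction of \<open>x - t *\<^sub>R grad_dir g y\<close>, the point of the ball that is
extremal for \<open>- grad_dir g y\<close>, leaves only equality in the Cauchy--Schwarz inequality.\<close>

lemma minimizer_imp_char_pt:
  fixes g :: "real ^ 'n \<Rightarrow> real"
  assumes g: "C2 g" and "0 \<le> t" and m: "minimizer g x t y" and p: "grad g y \<noteq> 0"
  shows "x = char_pt g y t"
proof -
  let ?v = "grad_dir g y"
  define d where "d = x - t *\<^sub>R ?v - y"
  have y: "y \<in> cball x t" and min: "\<And>z. z \<in> cball x t \<Longrightarrow> g y \<le> g z"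
    using m minimizer_iff[OF g assms(2)] by auto
  have vv: "?v \<bullet> ?v = 1" using norm_grad_dir[OF p] by (simp add: norm_eq_1)
  have end_in: "y + d \<in> cball x t"
    using norm_grad_dir[OF p] assms(2) by (simp add: d_def dist_norm)
  have "0 \<le> d \<bullet> grad g y"
  proof (rule ccontr)
    assume "\<not> 0 \<le> d \<bullet> grad g y"
    then have neg: "d \<bullet> grad g y < 0" by simp
    have "((\<lambda>s. g (y + s *\<^sub>R d)) has_derivative (\<lambda>k. (k *\<^sub>R d) \<bullet> grad g (y + 0 *\<^sub>R d))) (at 0)"
      by (rule has_derivative_compose[where g = g, unfolded o_def, OF _ C2_has_derivative[OF g]])
         (auto intro!: derivative_eq_intros)
    then have "DERIV (\<lambda>s. g (y + s *\<^sub>R d)) 0 :> d \<bullet> grad g y"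
      by (simp add: has_field_derivative_def mult_commute_abs)
    from DERIV_neg_dec_right[OF this neg]
    obtain e where e: "0 < e" "\<And>h. \<lbrakk>0 < h; h < e\<rbrakk> \<Longrightarrow> g (y + h *\<^sub>R d) < g y"
      by auto
    define h where "h = min (e / 2) 1"
    have h: "0 < h" "h < e" "h \<le> 1" using e(1) by (auto simp: h_def)
    have "y + h *\<^sub>R d \<in> closed_segment y (y + d)"
      using h by (auto simp: closed_segment_def algebra_simps intro!: exI[of _ h])
    then have "y + h *\<^sub>R d \<in> cball x t"
      using closed_segment_subset[OF y end_in convex_cball] by blast
    then show False using min e(2)[OF h(1,2)] by force
  qed
  then have "0 \<le> d \<bullet> ?v" using p by (simp add: inner_grad zero_le_mult_iff)
  then have "t \<le> (x - y) \<bullet> ?v"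
    using vv by (simp add: d_def inner_diff_left)
  then have "t * t \<le> t * ((x - y) \<bullet> ?v)" using assms(2) by (intro mult_left_mono)
  moreover have "(norm (x - y))\<^sup>2 \<le> t\<^sup>2"
    using y by (intro power_mono) (auto simp: dist_norm)
  moreover have "(norm (x - y - t *\<^sub>R ?v))\<^sup>2 = (norm (x - y))\<^sup>2 - 2 * (t * ((x - y) \<bullet> ?v)) + t * t"
    using vv unfolding power2_norm_eq_inner
    by (simp add: inner_diff_left inner_diff_right inner_commute algebra_simps)
  ultimately have "(norm (x - y - t *\<^sub>R ?v))\<^sup>2 \<le> 0" by (simp add: power2_eq_square)
  then show ?thesis by (simp add: char_pt_grad_dir algebra_simps)
qed

text \<open>Danskin's theorem after the substitution \<open>y = x + t *\<^sub>R e\<close>, which replaces the moving ball by the unit ball.\<close>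

lemma hopf_lax_has_derivative:
  fixes g :: "real ^ 'n \<Rightarrow> real"
  assumes g: "C2 g" and "0 < t"
    and same: "\<And>y. minimizer g x t y \<Longrightarrow> grad g y = p \<and> grad g y \<bullet> ((y - x) /\<^sub>R t) = q"
  shows "((\<lambda>(x, t). hopf_lax g x t) has_derivative (\<lambda>h. h \<bullet> (p, q))) (at (x, t))"
proof (rule has_derivative_min_over_compact[where K = "cball 0 1" and S = "{z. 0 < snd z}"
      and f = "\<lambda>z e. g (fst z + snd z *\<^sub>R e)"
      and G = "\<lambda>z e. (grad g (fst z + snd z *\<^sub>R e), grad g (fst z + snd z *\<^sub>R e) \<bullet> e)"])
  have point: "x + t *\<^sub>R e \<in> cball x t \<longleftrightarrow> e \<in> cball 0 1" if "0 < t" for x e :: "real ^ 'n" and t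
    using that by (simp add: dist_norm)
  have inv: "x + t *\<^sub>R ((y - x) /\<^sub>R t) = y" if "0 < t" for x y :: "real ^ 'n" and t
    using that by simp
  have val: "minimizer g x t y \<Longrightarrow> hopf_lax g x t = g y" for x t y by (simp add: minimizer_def)
  show "compact (cball (0 :: real ^ 'n) 1)" by simp
  show "open {z :: (real ^ 'n) \<times> real. 0 < snd z}"
    by (intro open_Collect_less continuous_intros)
  show "(x, t) \<in> {z. 0 < snd z}" using assms(2) by simp
  show "\<exists>e\<in>cball 0 1. g (fst z + snd z *\<^sub>R e) = (case z of (x, t) \<Rightarrow> hopf_lax g x t)"
    if "z \<in> {z. 0 < snd z}" for z
  proof -
    obtain x t where z: "z = (x, t)" by fastforce
    with that have t: "0 < t" by simp
    obtain y where y: "minimizer g x t y" using minimizer_exists[OF g, of t x] t by auto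
    then have "y \<in> cball x t" using minimizer_iff[OF g, of t x y] t by auto
    then have "(y - x) /\<^sub>R t \<in> cball 0 1" using point[OF t, of x "(y - x) /\<^sub>R t"] inv[OF t, of x y] by simp
    then show ?thesis using inv[OF t, of x y] val[OF y] z by (intro bexI[of _ "(y - x) /\<^sub>R t"]) auto
  qed
  show "(case z of (x, t) \<Rightarrow> hopf_lax g x t) \<le> g (fst z + snd z *\<^sub>R e)"
    if "z \<in> {z. 0 < snd z}" "e \<in> cball 0 1" for z e
  proof -
    obtain x t where z: "z = (x, t)" by fastforce
    with that have t: "0 < t" by simp
    obtain y where y: "minimizer g x t y" using minimizer_exists[OF g, of t x] t by auto
    then have "g y \<le> g (x + t *\<^sub>R e)"
      using minimizer_iff[OF g, of t x y] t point[OF t, of x e] that by auto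
    then show ?thesis using val[OF y] z by simp
  qed
  show "((\<lambda>z. g (fst z + snd z *\<^sub>R e)) has_derivative (\<lambda>h. h \<bullet>
      (grad g (fst z + snd z *\<^sub>R e), grad g (fst z + snd z *\<^sub>R e) \<bullet> e))) (at z)" for z e
  proof -
    have "((\<lambda>z. fst z + snd z *\<^sub>R e) has_derivative (\<lambda>h. fst h + snd h *\<^sub>R e)) (at z)"
      by (auto intro!: derivative_eq_intros)
    from has_derivative_compose[OF this C2_has_derivative[OF g]]
    have "((\<lambda>z. g (fst z + snd z *\<^sub>R e)) has_derivative
        (\<lambda>h. (fst h + snd h *\<^sub>R e) \<bullet> grad g (fst z + snd z *\<^sub>R e))) (at z)" by (simp add: o_def)
    then show ?thesis by (simp add: inner_prod_def inner_add_left inner_commute)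
  qed
  show "continuous_on ({z. 0 < snd z} \<times> cball 0 1) (\<lambda>(z, e). g (fst z + snd z *\<^sub>R e))"
    unfolding case_prod_beta
    by (rule continuous_on_compose2[OF C2_continuous_on[OF g, of UNIV]]) (auto intro!: continuous_intros)
  have "continuous_on ({z. 0 < snd z} \<times> cball 0 1) (\<lambda>x. grad g (fst (fst x) + snd (fst x) *\<^sub>R snd x))"
    by (rule continuous_on_compose2[OF C2_continuous_on_grad[OF g, of UNIV]]) (auto intro!: continuous_intros)
  then show "continuous_on ({z. 0 < snd z} \<times> cball 0 1)
      (\<lambda>(z, e). (grad g (fst z + snd z *\<^sub>R e), grad g (fst z + snd z *\<^sub>R e) \<bullet> e))"
    unfolding case_prod_beta by (intro continuous_intros)
  show "(grad g (fst (x, t) + snd (x, t) *\<^sub>R e), grad g (fst (x, t) + snd (x, t) *\<^sub>R e) \<bullet> e) = (p, q)"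
    if "e \<in> cball 0 1" "g (fst (x, t) + snd (x, t) *\<^sub>R e) = (case (x, t) of (x, t) \<Rightarrow> hopf_lax g x t)" for e
  proof -
    have "minimizer g x t (x + t *\<^sub>R e)"
      using that point[OF assms(2), of x e] by (simp add: minimizer_def dist_norm)
    from same[OF this] assms(2) show ?thesis by auto
  qed
qed

text \<open>Translating a minimizer \<open>y\<close> along with \<open>x\<close> gives the upper bound \<open>g (y + k)\<close> for the solution at
\<open>x + k\<close>, with equality at \<open>k = 0\<close>; so the derivatives agree.\<close>

lemma grad_minimizer_eq_derivative:
  assumes g: "C2 g" and "0 \<le> t" and m: "minimizer g x t y"
    and D: "((\<lambda>(x, t). hopf_lax g x t) has_derivative D) (at (x, t))"
  shows "h \<bullet> grad g y = D (h, 0)"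
proof -
  let ?\<phi> = "\<lambda>k. g (y + k) - hopf_lax g (x + k) t"
  have 1: "((\<lambda>k. g (y + k)) has_derivative (\<lambda>k. k \<bullet> grad g (y + 0))) (at 0)"
    by (rule has_derivative_compose[where g = g, unfolded o_def, OF _ C2_has_derivative[OF g]])
       (auto intro!: derivative_eq_intros)
  have "((\<lambda>k. (x + k, t)) has_derivative (\<lambda>k. (k, 0))) (at 0)"
    by (auto intro!: derivative_eq_intros)
  from has_derivative_compose[OF this, of "\<lambda>(x, t). hopf_lax g x t" D] D
  have 2: "((\<lambda>k. hopf_lax g (x + k) t) has_derivative (\<lambda>k. D (k, 0))) (at 0)" by (simp add: o_def)
  have "?\<phi> 0 \<le> ?\<phi> k" for k
  proof -
    obtain z where z: "minimizer g (x + k) t z" using minimizer_exists[OF g assms(2)] by blast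
    have "y + k \<in> cball (x + k) t" using m by (simp add: minimizer_def dist_norm norm_minus_commute)
    then have "hopf_lax g (x + k) t \<le> g (y + k)"
      using z minimizer_iff[OF g assms(2), of "x + k" z] by (simp add: minimizer_def)
    then show ?thesis using m by (simp add: minimizer_def)
  qed
  then have "(\<lambda>k. k \<bullet> grad g (y + 0) - D (k, 0)) = (\<lambda>k. 0)"
    using differential_zero_maxmin[of 0 UNIV ?\<phi>, OF _ _ has_derivative_diff[OF 1 2]] by simp
  from fun_cong[OF this, of h] show ?thesis by simp
qed

proposition Sigma_Un_T1_eq:
  fixes g :: "real ^ 'n \<Rightarrow> real"
  assumes g: "C2 g"
  shows "Sigma_set g \<union> T1_set g = T_set g (M_set g)"
proof (intro equalityI subsetI)
  fix X assume X: "X \<in> Sigma_set g \<union> T1_set g"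
  obtain x t where xt: "X = (x, t)" by fastforce
  show "X \<in> T_set g (M_set g)"
  proof (cases "X \<in> T1_set g")
    case True
    then show ?thesis by (auto simp: T1_set_def)
  next
    case False
    with X xt have t: "0 < t" and sing: "\<not> (\<lambda>(x, t). hopf_lax g x t) differentiable (at (x, t))"
      by (auto simp: Sigma_set_def)
    obtain y where y: "minimizer g x t y" "grad g y \<noteq> 0"
    proof (rule ccontr)
      assume "\<not> thesis"
      with that have "\<And>y. minimizer g x t y \<Longrightarrow> grad g y = 0" by blast
      then have "((\<lambda>(x, t). hopf_lax g x t) has_derivative (\<lambda>h. h \<bullet> (0, 0))) (at (x, t))"
        by (intro hopf_lax_has_derivative[OF g t]) auto
      with sing show False by (auto simp: differentiable_def)
    qed
    have "\<not> unique_minimizer g x t y"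
    proof
      assume "unique_minimizer g x t y"
      then have "((\<lambda>(x, t). hopf_lax g x t) has_derivative
          (\<lambda>h. h \<bullet> (grad g y, grad g y \<bullet> ((y - x) /\<^sub>R t)))) (at (x, t))"
        by (intro hopf_lax_has_derivative[OF g t]) (auto simp: unique_minimizer_def)
      with sing show False by (auto simp: differentiable_def)
    qed
    moreover have x: "x = char_pt g y t" using minimizer_imp_char_pt[OF g _ y] t by simp
    ultimately have nu: "\<not> strict_min_at g y t"
      using unique_minimizer_char_pt[OF g y(2), of t] t by simp
    then have "y \<in> M_set g" using M_set_iff[OF g] y t by blast
    moreover have "min_at g y t" using minimizer_char_pt[OF g y(2), of t] y x t by simp
    moreover have "\<not> strict_min_at g y \<tau>" if "t < \<tau>" for \<tau>
      using nu strict_min_at_mono[of g y \<tau> t] that t by auto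
    ultimately show ?thesis using T_set_iff[OF g subset_refl] x t xt by blast
  qed
next
  fix X assume X: "X \<in> T_set g (M_set g)"
  obtain x t where xt: "X = (x, t)" by fastforce
  obtain y where y: "y \<in> M_set g" "x = char_pt g y t" "0 < t" "min_at g y t"
    using X xt T_set_iff[OF g subset_refl] by blast
  have p: "grad g y \<noteq> 0" using y by (simp add: M_set_def)
  have my: "minimizer g x t y" using minimizer_char_pt[OF g p, of t] y by simp
  show "X \<in> Sigma_set g \<union> T1_set g"
  proof (cases "\<exists>!y. minimizer g x t y")
    case True
    then show ?thesis using X xt by (simp add: T1_set_def)
  next
    case False
    then obtain z where z: "minimizer g x t z" "z \<noteq> y" using my by blast
    have "\<not> (\<lambda>(x, t). hopf_lax g x t) differentiable (at (x, t))"
    proof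
      assume "(\<lambda>(x, t). hopf_lax g x t) differentiable (at (x, t))"
      then obtain D where D: "((\<lambda>(x, t). hopf_lax g x t) has_derivative D) (at (x, t))"
        by (auto simp: differentiable_def)
      have "h \<bullet> grad g y = h \<bullet> grad g z" for h
        using grad_minimizer_eq_derivative[OF g _ my D] grad_minimizer_eq_derivative[OF g _ z(1) D] y(3)
        by simp
      then have eq: "grad g y = grad g z" using vector_eq_ldot by blast
      have "x = char_pt g z t" using minimizer_imp_char_pt[OF g _ z(1)] y(3) p eq by simp
      with y(2) z(2) eq show False by (simp add: char_pt_def)
    qed
    then show ?thesis using y(3) xt by (simp add: Sigma_set_def)
  qed
qed

section \<open>Level sets near a regular point\<close>

text \<open>Every point of the superlevel set flows along \<open>v\<close>, without leaving it, into the convex set \<open>P\<close>.\<close>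

lemma path_connected_superlevel:
  fixes f :: "'a::real_normed_vector \<Rightarrow> real"
  assumes "convex N" and P: "convex P" "P \<subseteq> {y \<in> N. c < f y}"
    and flow: "\<And>y. y \<in> N \<Longrightarrow> \<exists>\<tau>\<ge>0. y + \<tau> *\<^sub>R v \<in> P"
    and mono: "\<And>y \<tau>. \<lbrakk>y \<in> N; 0 \<le> \<tau>; y + \<tau> *\<^sub>R v \<in> N\<rbrakk> \<Longrightarrow> f y \<le> f (y + \<tau> *\<^sub>R v)"
  shows "path_connected {y \<in> N. c < f y}"
proof -
  let ?A = "{y \<in> N. c < f y}"
  have to_P: "\<exists>p\<in>P. path_component ?A y p" if y: "y \<in> ?A" for y
  proof -
    obtain \<tau> where t: "0 \<le> \<tau>" "y + \<tau> *\<^sub>R v \<in> P" using flow y by blast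
    have "closed_segment y (y + \<tau> *\<^sub>R v) \<subseteq> ?A"
    proof
      fix x assume x: "x \<in> closed_segment y (y + \<tau> *\<^sub>R v)"
      then obtain u where u: "0 \<le> u" "u \<le> 1" "x = (1 - u) *\<^sub>R y + u *\<^sub>R (y + \<tau> *\<^sub>R v)"
        unfolding closed_segment_def by blast
      then have x_eq: "x = y + (u * \<tau>) *\<^sub>R v" by (simp add: algebra_simps)
      have "y + \<tau> *\<^sub>R v \<in> N" "y \<in> N" using t P(2) y by auto
      then have "x \<in> N"
        using closed_segment_subset[OF _ _ \<open>convex N\<close>] x by blast
      moreover have "f y \<le> f x"
        using mono[of y "u * \<tau>"] \<open>x \<in> N\<close> u t y unfolding x_eq by simp
      ultimately show "x \<in> ?A" using y by auto
    qed
    then have "path_component ?A y (y + \<tau> *\<^sub>R v)"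
      by (rule path_component_linepath)
    with t show ?thesis by blast
  qed
  have in_P: "path_component ?A p q" if "p \<in> P" "q \<in> P" for p q
  proof -
    have "path_component P p q"
      using convex_imp_path_connected[OF P(1)] that by (simp add: path_connected_component)
    with P(2) show ?thesis by (rule path_component_of_subset)
  qed
  show ?thesis
    unfolding path_connected_component
  proof (intro ballI)
    fix x y assume x: "x \<in> ?A" and y: "y \<in> ?A"
    obtain p where p: "p \<in> P" "path_component ?A x p" using to_P[OF x] by blast
    obtain q where q: "q \<in> P" "path_component ?A y q" using to_P[OF y] by blast
    show "path_component ?A x y"
      by (rule path_component_trans[OF p(2) path_component_trans[OF in_P[OF p(1) q(1)]
            path_component_sym[OF q(2)]]])
  qed
qed

text \<open>Near \<open>y0\<close> the function increases along all segments whose direction is close to that of the gradient at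
\<open>y0\<close>; one radius \<open>r\<close> serves both as size of the neighbourhood and as opening of the cone of directions.\<close>

lemma ascent_cone:
  fixes g :: "real ^ 'n \<Rightarrow> real"
  assumes g: "C2 g" and p: "grad g y0 \<noteq> 0"
  obtains r where "0 < r" "\<And>x. x \<in> ball y0 r \<Longrightarrow> grad g x \<noteq> 0"
    "\<And>x x' s. \<lbrakk>x \<in> ball y0 r; x' \<in> ball y0 r; 0 < s; norm (x' - x - s *\<^sub>R grad_dir g y0) < r * s\<rbrakk> \<Longrightarrow> g x < g x'"
proof -
  let ?v = "grad_dir g y0"
  have "open {z :: (real ^ 'n) \<times> (real ^ 'n). 0 < snd z \<bullet> grad g (fst z)}"
    by (intro open_Collect_less continuous_intros
        continuous_on_compose2[OF C2_continuous_on_grad[OF g, of UNIV]]) auto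
  moreover have "(y0, ?v) \<in> {z. 0 < snd z \<bullet> grad g (fst z)}"
    using p norm_grad_dir[OF p] by (simp add: inner_grad norm_eq_1)
  ultimately obtain A B where AB: "open A" "open B" "(y0, ?v) \<in> A \<times> B"
    "A \<times> B \<subseteq> {z. 0 < snd z \<bullet> grad g (fst z)}"
    by (rule open_prod_elim)
  obtain r1 r2 where r: "0 < r1" "ball y0 r1 \<subseteq> A" "0 < r2" "ball ?v r2 \<subseteq> B"
    using AB open_contains_ball by (metis mem_Sigma_iff)
  define r where "r = min r1 r2"
  have cone: "0 < d \<bullet> grad g x" if "x \<in> ball y0 r" "norm (d - ?v) < r" for x d
  proof -
    have "x \<in> A" "d \<in> B" using that r by (auto simp: r_def dist_norm norm_minus_commute subset_iff)
    then show ?thesis using AB(4) by auto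
  qed
  show thesis
  proof (rule that[of r])
    show r_pos: "0 < r" using r by (simp add: r_def)
    show "grad g x \<noteq> 0" if "x \<in> ball y0 r" for x
      using cone[OF that, of ?v] r_pos by auto
    show "g x < g x'" if x: "x \<in> ball y0 r" "x' \<in> ball y0 r"
      and s: "0 < s" "norm (x' - x - s *\<^sub>R ?v) < r * s" for x x' s
    proof -
      obtain z where z: "z \<in> closed_segment x x'" "g x' - g x = (x' - x) \<bullet> grad g z"
        using mean_value_along_segment[of x x' g "grad g"] C2_has_derivative[OF g] by blast
      have "z \<in> ball y0 r" using z(1) closed_segment_subset[OF x convex_ball] by blast
      moreover have "norm ((x' - x) /\<^sub>R s - ?v) < r"
      proof -
        have "(x' - x) /\<^sub>R s - ?v = (x' - x - s *\<^sub>R ?v) /\<^sub>R s"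
          using s(1) by (simp add: scaleR_diff_right)
        then have "norm ((x' - x) /\<^sub>R s - ?v) = norm (x' - x - s *\<^sub>R ?v) / s"
          using s(1) by (simp add: divide_inverse_commute)
        then show ?thesis using s by (simp add: pos_divide_less_eq)
      qed
      ultimately have "0 < ((x' - x) /\<^sub>R s) \<bullet> grad g z" by (rule cone)
      then show ?thesis using z(2) s(1) by (simp add: zero_less_mult_iff)
    qed
  qed
qed

text \<open>The neighbourhood is a cylinder with axis along the gradient and coordinates \<open>\<sigma>\<close> (height) and \<open>\<kappa>\<close>
(displacement from the axis). It is so thin that the upper and the lower part \<open>U\<close>, \<open>L\<close> of
height \<open>a / 2\<close> lie entirely above and below the level, by \<open>ascent_cone\<close>; flowing along the axis connects each side to
\<open>U\<close> or \<open>L\<close>.\<close>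

lemma separated_nbhd_exists:
  fixes g :: "real ^ 'n \<Rightarrow> real"
  assumes g: "C2 g" and p: "grad g y0 \<noteq> 0" and "0 < e"
  obtains N where "separated_nbhd g y0 N" "N \<subseteq> ball y0 e" "path_connected (H_plus g N y0)"
proof -
  let ?v = "grad_dir g y0"
  obtain r where r: "0 < r" "\<And>x. x \<in> ball y0 r \<Longrightarrow> grad g x \<noteq> 0"
    "\<And>x x' s. \<lbrakk>x \<in> ball y0 r; x' \<in> ball y0 r; 0 < s; norm (x' - x - s *\<^sub>R ?v) < r * s\<rbrakk> \<Longrightarrow> g x < g x'"
    using ascent_cone[OF g p] by blast
  have vv: "?v \<bullet> ?v = 1" using norm_grad_dir[OF p] by (simp add: norm_eq_1)
  \<comment> \<open>\<open>a + b \<le> min e r\<close> keeps the cylinder in both balls, \<open>b \<le> r * (a / 2)\<close> keeps \<open>U\<close> and \<open>L\<close> in the cone.\<close>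
  define a where "a = min e r / 2"
  define b where "b = min a (r * (a / 2))"
  have a: "0 < a" and b: "0 < b" "b \<le> r * (a / 2)" "a + b \<le> min e r"
    using \<open>0 < e\<close> r(1) by (auto simp: a_def b_def)
  define \<sigma> where "\<sigma> = (\<lambda>y. (y - y0) \<bullet> ?v)"
  define \<kappa> where "\<kappa> = (\<lambda>y. y - y0 - \<sigma> y *\<^sub>R ?v)"
  define N where "N = {y. \<bar>\<sigma> y\<bar> < a \<and> norm (\<kappa> y) < b}"
  have \<sigma>_move: "\<sigma> (y + \<tau> *\<^sub>R ?v) = \<sigma> y + \<tau>" for y \<tau>
    using vv by (simp add: \<sigma>_def inner_add_left inner_diff_left)
  have \<kappa>_move: "\<kappa> (y + \<tau> *\<^sub>R ?v) = \<kappa> y" for y \<tau>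
    by (simp add: \<kappa>_def \<sigma>_move algebra_simps)
  have \<sigma>_back: "\<sigma> (y - \<tau> *\<^sub>R ?v) = \<sigma> y - \<tau>" and \<kappa>_back: "\<kappa> (y - \<tau> *\<^sub>R ?v) = \<kappa> y" for y \<tau>
    using \<sigma>_move[of y "- \<tau>"] \<kappa>_move[of y "- \<tau>"] by simp_all
  have N_ball: "y \<in> ball y0 r" "y \<in> ball y0 e" if "y \<in> N" for y
  proof -
    have "y - y0 = \<sigma> y *\<^sub>R ?v + \<kappa> y" by (simp add: \<kappa>_def)
    then have "norm (y - y0) \<le> \<bar>\<sigma> y\<bar> + norm (\<kappa> y)"
      using norm_triangle_ineq[of "\<sigma> y *\<^sub>R ?v" "\<kappa> y"] norm_grad_dir[OF p] by simp
    also have "\<dots> < a + b" using that by (auto simp: N_def)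
    finally have "dist y0 y < min e r" using b(3) by (simp add: dist_norm norm_minus_commute)
    then show "y \<in> ball y0 r" "y \<in> ball y0 e" by auto
  qed
  have affine: "\<sigma> (u *\<^sub>R x + v *\<^sub>R y) = u * \<sigma> x + v * \<sigma> y"
    "\<kappa> (u *\<^sub>R x + v *\<^sub>R y) = u *\<^sub>R \<kappa> x + v *\<^sub>R \<kappa> y" if "u + v = 1" for u v x y
  proof -
    have "y0 = u *\<^sub>R y0 + v *\<^sub>R y0" using that by (simp flip: scaleR_add_left)
    then have *: "u *\<^sub>R x + v *\<^sub>R y - y0 = u *\<^sub>R (x - y0) + v *\<^sub>R (y - y0)"
      by (simp add: algebra_simps)
    then show s: "\<sigma> (u *\<^sub>R x + v *\<^sub>R y) = u * \<sigma> x + v * \<sigma> y"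
      by (simp add: \<sigma>_def inner_add_left)
    show "\<kappa> (u *\<^sub>R x + v *\<^sub>R y) = u *\<^sub>R \<kappa> x + v *\<^sub>R \<kappa> y"
      unfolding \<kappa>_def s * by (simp add: algebra_simps)
  qed
  have "convex N"
  proof (rule convexI)
    fix x y and u v :: real assume xy: "x \<in> N" "y \<in> N" and uv: "0 \<le> u" "0 \<le> v" "u + v = 1"
    have "\<bar>\<sigma> (u *\<^sub>R x + v *\<^sub>R y)\<bar> \<le> u * \<bar>\<sigma> x\<bar> + v * \<bar>\<sigma> y\<bar>"
      unfolding affine(1)[OF uv(3)] using uv abs_triangle_ineq[of "u * \<sigma> x" "v * \<sigma> y"] by (simp add: abs_mult)
    also have "\<dots> < a" using xy uv by (intro convex_bound_lt) (auto simp: N_def)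
    finally have 1: "\<bar>\<sigma> (u *\<^sub>R x + v *\<^sub>R y)\<bar> < a" .
    have "norm (\<kappa> (u *\<^sub>R x + v *\<^sub>R y)) \<le> u * norm (\<kappa> x) + v * norm (\<kappa> y)"
      unfolding affine(2)[OF uv(3)] using uv norm_triangle_ineq[of "u *\<^sub>R \<kappa> x" "v *\<^sub>R \<kappa> y"] by simp
    also have "\<dots> < b" using xy uv by (intro convex_bound_lt) (auto simp: N_def)
    finally show "u *\<^sub>R x + v *\<^sub>R y \<in> N" using 1 by (simp add: N_def)
  qed
  have "open N"
  proof -
    have "N = {y. \<bar>\<sigma> y\<bar> < a} \<inter> {y. norm (\<kappa> y) < b}" by (auto simp: N_def)
    then show ?thesis
      unfolding \<kappa>_def \<sigma>_def by (auto intro!: open_Int open_Collect_less continuous_intros)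
  qed
  define U where "U = N \<inter> {y. a / 2 \<le> \<sigma> y}"
  define L where "L = N \<inter> {y. \<sigma> y \<le> - (a / 2)}"
  have half: "{y. c \<le> \<sigma> y} = {y. ?v \<bullet> y \<ge> c + ?v \<bullet> y0}" "{y. \<sigma> y \<le> c} = {y. ?v \<bullet> y \<le> c + ?v \<bullet> y0}" for c
    by (auto simp: \<sigma>_def inner_diff_left inner_commute)
  have "convex U" "convex L"
    unfolding U_def L_def half
    by (intro convex_Int \<open>convex N\<close> convex_halfspace_ge convex_halfspace_le)+
  have N_y0: "y0 + \<tau> *\<^sub>R ?v \<in> N" if "\<bar>\<tau>\<bar> < a" for \<tau>
  proof -
    have "\<sigma> y0 = 0" "\<kappa> y0 = 0" by (simp_all add: \<sigma>_def \<kappa>_def)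
    then show ?thesis using that b(1) by (simp add: N_def \<sigma>_move \<kappa>_move)
  qed
  then have y0N: "y0 \<in> N" using a by (metis abs_zero add.right_neutral scaleR_zero_left)
  have above: "g y0 < g y" if "y \<in> U" for y
  proof (rule r(3)[where s = "\<sigma> y"])
    have y: "y \<in> N" "a / 2 \<le> \<sigma> y" using that by (auto simp: U_def)
    then show "0 < \<sigma> y" using a by simp
    have "norm (\<kappa> y) < b" using y by (simp add: N_def)
    also have "\<dots> \<le> r * (a / 2)" by (rule b(2))
    also have "\<dots> \<le> r * \<sigma> y" using y(2) r(1) by (intro mult_left_mono) auto
    finally show "norm (y - y0 - \<sigma> y *\<^sub>R ?v) < r * \<sigma> y" by (simp add: \<kappa>_def)
    show "y \<in> ball y0 r" using N_ball y by blast
  qed (use r in simp)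
  have below: "g y < g y0" if "y \<in> L" for y
  proof (rule r(3)[where s = "- \<sigma> y"])
    have y: "y \<in> N" "a / 2 \<le> - \<sigma> y" using that by (auto simp: L_def)
    then show "0 < - \<sigma> y" using a by simp
    have "norm (\<kappa> y) < b" using y by (simp add: N_def)
    also have "\<dots> \<le> r * (a / 2)" by (rule b(2))
    also have "\<dots> \<le> r * - \<sigma> y" using y(2) r(1) by (intro mult_left_mono) auto
    finally have "norm (- \<kappa> y) < r * - \<sigma> y" by simp
    moreover have "y0 - y - (- \<sigma> y) *\<^sub>R ?v = - \<kappa> y" by (simp add: \<kappa>_def)
    ultimately show "norm (y0 - y - (- \<sigma> y) *\<^sub>R ?v) < r * - \<sigma> y" by simp
    show "y \<in> ball y0 r" using N_ball y by blast
  qed (use r in simp)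
  have mono: "g y \<le> g (y + \<tau> *\<^sub>R ?v)" if "y \<in> N" "0 \<le> \<tau>" "y + \<tau> *\<^sub>R ?v \<in> N" for y \<tau>
  proof (cases "\<tau> = 0")
    case False
    then show ?thesis
      using r(3)[of y "y + \<tau> *\<^sub>R ?v" \<tau>] N_ball that r(1) by (simp add: less_imp_le)
  qed simp
  have up: "path_connected {y \<in> N. g y0 < g y}"
  proof (rule path_connected_superlevel[OF \<open>convex N\<close> \<open>convex U\<close>, where v = ?v])
    show "U \<subseteq> {y \<in> N. g y0 < g y}" using above by (auto simp: U_def)
    show "\<exists>\<tau>\<ge>0. y + \<tau> *\<^sub>R ?v \<in> U" if "y \<in> N" for y
      using that a
      by (intro exI[of _ "max 0 (a / 2 - \<sigma> y)"]) (auto simp: U_def N_def \<sigma>_move \<kappa>_move max_def)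
  qed (rule mono)
  have "path_connected {y \<in> N. - g y0 < - g y}"
  proof (rule path_connected_superlevel[OF \<open>convex N\<close> \<open>convex L\<close>, where v = "- ?v"])
    show "L \<subseteq> {y \<in> N. - g y0 < - g y}" using below by (auto simp: L_def)
    have down: "y + \<tau> *\<^sub>R - ?v = y + (- \<tau>) *\<^sub>R ?v" for y \<tau> by simp
    show "\<exists>\<tau>\<ge>0. y + \<tau> *\<^sub>R - ?v \<in> L" if "y \<in> N" for y
      unfolding down using that a
      by (intro exI[of _ "max 0 (a / 2 + \<sigma> y)"]) (auto simp: L_def N_def \<sigma>_back \<kappa>_back max_def)
    show "- g y \<le> - g (y + \<tau> *\<^sub>R - ?v)" if "y \<in> N" "0 \<le> \<tau>" "y + \<tau> *\<^sub>R - ?v \<in> N" for y \<tau>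
      using mono[OF that(3,2)] that by simp
  qed
  then have lo: "path_connected {y \<in> N. g y < g y0}" by simp
  have "separated_nbhd g y0 N"
    unfolding separated_nbhd_def
  proof (intro conjI)
    show "open N" "y0 \<in> N" "connected N" by (fact \<open>open N\<close> y0N convex_connected[OF \<open>convex N\<close>])+
    show "\<forall>y\<in>N. g y = g y0 \<longrightarrow> grad g y \<noteq> 0" using r(2) N_ball by blast
    have "y0 + (a / 2) *\<^sub>R ?v \<in> U"
      using N_y0[of "a / 2"] a \<sigma>_move[of y0 "a / 2"] by (simp add: U_def \<sigma>_def)
    with above show "{y \<in> N. g y > g y0} \<noteq> {}" by (auto simp: U_def)
    have "y0 + (- (a / 2)) *\<^sub>R ?v \<in> L"
      using N_y0[of "- (a / 2)"] a \<sigma>_move[of y0 "- (a / 2)"] by (simp add: L_def \<sigma>_def)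
    with below show "{y \<in> N. g y < g y0} \<noteq> {}" by (auto simp: L_def)
    show "connected {y \<in> N. g y > g y0}" "connected {y \<in> N. g y < g y0}"
      using up lo by (auto intro: path_connected_imp_connected)
  qed
  then show thesis
    using that N_ball up unfolding H_plus_def by blast
qed

section \<open>Path components of E and the sets F\<close>

lemma path_component_of_open:
  fixes E :: "'a::real_normed_vector set"
  assumes "open E" and C: "C \<in> path_components_of (top_of_set E)"
  shows "open C" "path_connected C" "C \<subseteq> E" "C \<noteq> {}"
proof -
  show sub: "C \<subseteq> E" using path_components_of_subset[OF C] by simp
  show "path_connected C"
    using path_connectedin_path_components_of[OF C] by (simp add: path_connectedin_subtopology)
  show "C \<noteq> {}" by (rule nonempty_path_components_of[OF C])
  have "\<exists>e>0. ball x e \<subseteq> C" if x: "x \<in> C" for x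
  proof -
    obtain e where e: "0 < e" "ball x e \<subseteq> E" using \<open>open E\<close> sub x open_contains_ball by blast
    have "path_connectedin (top_of_set E) (ball x e)"
      using e by (simp add: path_connectedin_subtopology convex_imp_path_connected)
    moreover have "\<not> disjnt C (ball x e)" using x e by (auto simp: disjnt_def)
    ultimately show ?thesis using path_components_of_maximal[OF C] e by blast
  qed
  then show "open C" using open_contains_ball by blast
qed

lemma countable_path_components_of_open:
  fixes E :: "'a::euclidean_space set"
  assumes "open E" shows "countable (path_components_of (top_of_set E))"
  using path_component_of_open(1)[OF assms] pairwise_disjoint_path_components_of
  by (rule countable_disjoint_open_subsets)

text \<open>Distinct components contain distinct members of the family.\<close>

lemma countable_path_components_of_Union:
  assumes "countable I" and pc: "\<And>i. i \<in> I \<Longrightarrow> path_connected (f i)" and X: "X = (\<Union>i\<in>I. f i)"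
  shows "countable (path_components_of (top_of_set X))"
proof -
  let ?P = "path_components_of (top_of_set X)"
  have "\<exists>i\<in>I. f i \<inter> P \<noteq> {} \<and> f i \<subseteq> P" if P: "P \<in> ?P" for P
  proof -
    obtain x where x: "x \<in> P" using nonempty_path_components_of[OF P] by blast
    moreover have "P \<subseteq> X" using path_components_of_subset[OF P] by simp
    ultimately obtain i where i: "i \<in> I" "x \<in> f i" using X by blast
    have "path_connectedin (top_of_set X) (f i)"
      using pc[OF i(1)] i(1) X by (auto simp: path_connectedin_subtopology)
    moreover have "\<not> disjnt P (f i)" using x i by (auto simp: disjnt_def)
    ultimately have "f i \<subseteq> P" by (rule path_components_of_maximal[OF P])
    with x i show ?thesis by blast
  qed
  then obtain h where h: "\<And>P. P \<in> ?P \<Longrightarrow> h P \<in> I \<and> f (h P) \<inter> P \<noteq> {} \<and> f (h P) \<subseteq> P" by metis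
  have "inj_on h ?P"
  proof (rule inj_onI)
    fix P Q assume PQ: "P \<in> ?P" "Q \<in> ?P" "h P = h Q"
    then have "\<not> disjnt P Q" using h[OF PQ(1)] h[OF PQ(2)] by (auto simp: disjnt_def)
    then show "P = Q"
      using pairwise_disjoint_path_components_of PQ by (meson pairwiseD)
  qed
  moreover have "countable (h ` ?P)"
    by (rule countable_subset[OF _ assms(1)]) (use h in blast)
  ultimately show ?thesis using countable_image_inj_on by blast
qed

lemma open_E_set:
  fixes g :: "real ^ 'n \<Rightarrow> real"
  assumes g: "C2 g" shows "open (E_set g)"
proof -
  have "E_set g = {y. grad g y \<noteq> 0} \<inter> (\<Union>z. {y. 0 < (z - y) \<bullet> grad g y} \<inter> {y. g z < g y})"
    by (auto simp: E_set_def H_half_def)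
  moreover have "open {y. grad g y \<noteq> 0}"
    by (intro open_Collect_neq C2_continuous_on_grad[OF g] continuous_intros)
  moreover have "open {y. 0 < (z - y) \<bullet> grad g y}" "open {y. g z < g y}" for z
    by (intro open_Collect_less C2_continuous_on_grad[OF g] C2_continuous_on[OF g] continuous_intros)+
  ultimately show ?thesis by (auto intro!: open_Int open_UN)
qed

lemma F_set_subset_M:
  assumes "C2 g" "C \<in> path_components_of (top_of_set (E_set g))" shows "F_set g C \<subseteq> M_set g"
  using path_component_of_open(3)[OF open_E_set[OF assms(1)] assms(2)] E_subset_M[OF assms(1)]
  by (auto simp: F_set_def)

text \<open>A competitor of \<open>y0\<close>, at most at its level, remains in the half space of nearby points \<open>y\<close>.\<close>

lemma eventually_in_E_above_level:
  fixes g :: "real ^ 'n \<Rightarrow> real"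
  assumes g: "C2 g" and M: "y0 \<in> M_set g"
  shows "\<forall>\<^sub>F y in nhds y0. g y0 < g y \<longrightarrow> y \<in> E_set g"
proof -
  have p: "grad g y0 \<noteq> 0" using M by (simp add: M_set_def)
  obtain t z where z: "0 < t" "z \<in> tangent_ball g y0 t" "z \<noteq> y0" "g z \<le> g y0"
    using M M_set_iff[OF g] by (auto simp: strict_min_at_def not_less)
  have "0 < (z - y0) \<bullet> grad g y0"
    using inner_grad_dir_pos[OF z(2) _ z(3)] z(1) p by (simp add: inner_grad)
  moreover have id: "((\<lambda>y. y) \<longlongrightarrow> y0) (nhds y0)" by (rule filterlim_ident)
  then have "((\<lambda>y. (z - y) \<bullet> grad g y) \<longlongrightarrow> (z - y0) \<bullet> grad g y0) (nhds y0)"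
    by (intro tendsto_intros C2_tendsto_grad[OF g])
  ultimately have "\<forall>\<^sub>F y in nhds y0. 0 < (z - y) \<bullet> grad g y"
    by (auto dest: order_tendstoD(1))
  then show ?thesis
  proof eventually_elim
    case (elim y)
    then have "grad g y \<noteq> 0" "z \<in> H_half g y" by (auto simp: H_half_def)
    then show ?case using z(4) unfolding E_set_def by (auto dest: order_le_less_trans)
  qed
qed

lemma M_eq_Union_F_set:
  fixes g :: "real ^ 'n \<Rightarrow> real"
  assumes g: "C2 g"
  shows "M_set g = (\<Union>C \<in> path_components_of (top_of_set (E_set g)). F_set g C)"
proof (intro equalityI subsetI)
  let ?P = "path_components_of (top_of_set (E_set g))"
  have cover: "\<exists>C\<in>?P. y \<in> C" if "y \<in> E_set g" for y
    using that Union_path_components_of[of "top_of_set (E_set g)"] by auto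
  fix y0 assume M: "y0 \<in> M_set g"
  then have p: "grad g y0 \<noteq> 0" by (simp add: M_set_def)
  show "y0 \<in> (\<Union>C\<in>?P. F_set g C)"
  proof (cases "y0 \<in> E_set g")
    case True
    with cover show ?thesis by (auto simp: F_set_def)
  next
    case False
    obtain e where e: "0 < e" "\<And>y. y \<in> ball y0 e \<Longrightarrow> g y0 < g y \<Longrightarrow> y \<in> E_set g"
      using eventually_in_E_above_level[OF g M] unfolding eventually_nhds_metric
      by (auto simp: dist_commute)
    obtain N where N: "separated_nbhd g y0 N" "N \<subseteq> ball y0 e" "path_connected (H_plus g N y0)"
      using separated_nbhd_exists[OF g p e(1)] by blast
    have "H_plus g N y0 \<noteq> {}" using N(1) by (auto simp: separated_nbhd_def H_plus_def)
    then obtain y where y: "y \<in> H_plus g N y0" by blast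
    have sub: "H_plus g N y0 \<subseteq> E_set g" using e(2) N(2) by (auto simp: H_plus_def)
    then obtain C where C: "C \<in> ?P" "y \<in> C" using cover y by blast
    have "path_connectedin (top_of_set (E_set g)) (H_plus g N y0)"
      using N(3) sub by (simp add: path_connectedin_subtopology)
    moreover have "\<not> disjnt C (H_plus g N y0)" using y C by (auto simp: disjnt_def)
    ultimately have "H_plus g N y0 \<subseteq> C" by (rule path_components_of_maximal[OF C(1)])
    moreover have "open N" "y0 \<in> N" using N(1) by (auto simp: separated_nbhd_def)
    ultimately have "y0 \<in> F_set g C"
      using M False N(1) unfolding F_set_def by blast
    with C(1) show ?thesis by blast
  qed
next
  fix y assume "y \<in> (\<Union>C \<in> path_components_of (top_of_set (E_set g)). F_set g C)"
  then show "y \<in> M_set g" using F_set_subset_M[OF g] by blast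
qed

lemma T_set_Union: "T_set g (\<Union>i\<in>I. S i) = (\<Union>i\<in>I. T_set g (S i))"
  unfolding T_set_def by blast

section \<open>Path connectedness over one component of E\<close>

text \<open>The earliest point of the set over \<open>y\<close>, which serves as its representative.\<close>

definition onset_pt :: "(real ^ 'n \<Rightarrow> real) \<Rightarrow> real ^ 'n \<Rightarrow> (real ^ 'n) \<times> real" where
  "onset_pt g y = (char_pt g y (last_strict_time g y), last_strict_time g y)"

text \<open>Along a segment on which \<open>g\<close> strictly increases, the semicontinuity properties say exactly that the
two threshold times have only downward jumps. The start \<open>y0\<close> may lie outside \<open>E_set g\<close>; over it the graph keeps
only the lower end of the fibre, to which both times converge from the right.\<close>

lemma segment_connects:
  fixes g :: "real ^ 'n \<Rightarrow> real" and y0 w :: "real ^ 'n"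
  assumes g: "C2 g" and S: "S \<subseteq> M_set g"
  defines "c \<equiv> \<lambda>s. y0 + s *\<^sub>R (w - y0)"
  assumes cE: "\<And>s. \<lbrakk>0 < s; s \<le> 1\<rbrakk> \<Longrightarrow> c s \<in> E_set g"
    and incr: "\<And>r s. \<lbrakk>0 \<le> r; r < s; s \<le> 1\<rbrakk> \<Longrightarrow> g (c r) < g (c s)"
    and cS: "\<And>s. \<lbrakk>0 \<le> s; s \<le> 1\<rbrakk> \<Longrightarrow> c s \<in> S"
  shows "path_component (T_set g S) (onset_pt g y0) (onset_pt g w)"
proof -
  define a where "a = (\<lambda>s. last_strict_time g (c s))"
  \<comment> \<open>The fibre over the initial point is cut down to its lower end.\<close>
  define b where "b = (\<lambda>s. if s = 0 then last_strict_time g (c s) else last_min_time g (c s))"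
  have cM: "c s \<in> M_set g" if "s \<in> {0..1}" for s using cS S that by auto
  have cp: "grad g (c s) \<noteq> 0" if "s \<in> {0..1}" for s using cM[OF that] by (simp add: M_set_def)
  have a_pos: "0 < a s" if "s \<in> {0..1}" for s unfolding a_def using last_strict_time(1)[OF g cM[OF that]] .
  have ab: "a s \<le> b s" if "s \<in> {0..1}" for s
    using last_min_time(5)[OF g cE, of s] that by (auto simp: a_def b_def)
  have b_min: "min_at g (c s) (b s)" if "s \<in> {0..1}" for s
    using last_min_time(4)[OF g cE, of s] last_strict_time(4)[OF g cM[OF that]] that by (auto simp: b_def)
  have b_less: "b s < t" if "s \<in> {0..1}" "\<not> min_at g (c s) t" "0 < t" for s t
    using min_at_mono[OF b_min[OF that(1)], of t] that by force
  have le_a: "t \<le> a s" if "s \<in> {0..1}" "strict_min_at g (c s) t" for s t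
    using last_strict_time(3)[OF g cM[OF that(1)], of t] that(2) unfolding a_def by force
  have near: "\<exists>d>0. \<forall>r\<in>{0..1}. \<bar>r - s\<bar> < d \<longrightarrow> P (c r)" if "\<forall>\<^sub>F y in nhds (c s). P y" for P s
  proof -
    have "(c \<longlongrightarrow> c s) (nhds s)"
      unfolding c_def by (intro tendsto_intros filterlim_ident)
    then have "\<forall>\<^sub>F r in nhds s. P (c r)" using that by (rule eventually_compose_filterlim[rotated])
    then show ?thesis unfolding eventually_nhds_metric dist_real_def by blast
  qed
  have "downward_jumps a b"
  proof
    show "a s \<le> b s" if "s \<in> {0..1}" for s by (rule ab[OF that])
    fix s e :: real assume s: "s \<in> {0..1}" and e: "0 < e"
    show "\<exists>d>0. \<forall>r\<in>{0..1}. s - d < r \<and> r < s \<longrightarrow> b s - e < a r \<and> b r < b s + e"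
    proof (cases "s = 0")
      case True
      then show ?thesis by (intro exI[of _ 1]) auto
    next
      case False
      then have sE: "c s \<in> E_set g" and bs: "b s = last_min_time g (c s)" using cE s by (auto simp: b_def)
      have bpos: "0 < b s" using last_min_time(1)[OF g sE] bs by simp
      \<comment> \<open>A positive time below \<open>b s\<close> by less than \<open>e\<close>.\<close>
      define t where "t = max (b s / 2) (b s - e / 2)"
      have t: "0 < t" "t < b s" "b s - e < t" using bpos e by (auto simp: t_def)
      obtain d1 where d1: "0 < d1"
        "\<And>r. \<lbrakk>r \<in> {0..1}; \<bar>r - s\<bar> < d1\<rbrakk> \<Longrightarrow> g (c r) < g (c s) \<longrightarrow> strict_min_at g (c r) t"
        using near[OF strict_min_at_below_level[OF g cp[OF s] b_min[OF s] t(1,2)]] by blast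
      have "last_min_time g (c s) < b s + e" using e bs by simp
      then obtain d2 where d2: "0 < d2"
        "\<And>r. \<lbrakk>r \<in> {0..1}; \<bar>r - s\<bar> < d2\<rbrakk> \<Longrightarrow> \<not> min_at g (c r) (b s + e)"
        using near[OF not_min_at_stable[OF g sE]] by blast
      show ?thesis
      proof (intro exI[of _ "min d1 d2"] conjI ballI impI)
        show "0 < min d1 d2" using d1 d2 by simp
        fix r assume r: "r \<in> {0..1}" "s - min d1 d2 < r \<and> r < s"
        then have rs: "\<bar>r - s\<bar> < d1" "\<bar>r - s\<bar> < d2" by auto
        have "g (c r) < g (c s)" using incr[of r s] r s by auto
        then show "b s - e < a r" using le_a[OF r(1), of t] d1(2)[OF r(1) rs(1)] t by auto
        show "b r < b s + e" using b_less[OF r(1) d2(2)[OF r(1) rs(2)]] bpos e by auto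
      qed
    qed
    show "\<exists>d>0. \<forall>r\<in>{0..1}. s < r \<and> r < s + d \<longrightarrow> a s - e < a r \<and> b r < a s + e"
    proof -
      have apos: "0 < a s" by (rule a_pos[OF s])
      define t where "t = max (a s / 2) (a s - e / 2)"
      have t: "0 < t" "t < a s" "a s - e < t" using apos e by (auto simp: t_def)
      have "strict_min_at g (c s) ((t + a s) / 2)"
        by (rule last_strict_time(2)[OF g cM[OF s]]) (use t in \<open>auto simp: a_def\<close>)
      then obtain d1 where d1: "0 < d1"
        "\<And>r. \<lbrakk>r \<in> {0..1}; \<bar>r - s\<bar> < d1\<rbrakk> \<Longrightarrow> strict_min_at g (c r) t"
        using near[OF strict_min_at_stable[OF g cp[OF s] _ t(1)]] t by force
      have "last_strict_time g (c s) < a s + e" using e by (simp add: a_def)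
      then obtain d2 where d2: "0 < d2"
        "\<And>r. \<lbrakk>r \<in> {0..1}; \<bar>r - s\<bar> < d2\<rbrakk> \<Longrightarrow> g (c s) < g (c r) \<longrightarrow> \<not> min_at g (c r) (a s + e)"
        using near[OF not_min_at_above_level[OF g cM[OF s]]] by blast
      show ?thesis
      proof (intro exI[of _ "min d1 d2"] conjI ballI impI)
        show "0 < min d1 d2" using d1 d2 by simp
        fix r assume r: "r \<in> {0..1}" "s < r \<and> r < s + min d1 d2"
        then have rs: "\<bar>r - s\<bar> < d1" "\<bar>r - s\<bar> < d2" by auto
        have *: "g (c s) < g (c r)" using incr[of s r] r s by auto
        show "a s - e < a r" using le_a[OF r(1), of t] d1(2)[OF r(1) rs(1)] t by auto
        have "\<not> min_at g (c r) (a s + e)" using d2(2)[OF r(1) rs(2)] * by blast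
        then show "b r < a s + e" using b_less[OF r(1)] apos e by auto
      qed
    qed
  qed
  then have pc: "path_connected (filled_graph a b)"
    by (rule downward_jumps.path_connected_filled_graph)
  let ?G = "filled_graph a b"
  define \<phi> where "\<phi> = (\<lambda>(s, t). (char_pt g (c s) t, t))"
  have "continuous_on ?G (\<lambda>x. grad_dir g (c (fst x)))"
  proof (rule continuous_on_compose2[OF continuous_on_grad_dir[OF g]])
    show "continuous_on ?G (\<lambda>x. c (fst x))" unfolding c_def by (intro continuous_intros)
    show "(\<lambda>x. c (fst x)) ` ?G \<subseteq> c ` {0..1}" by (auto simp: filled_graph_def)
  qed (use cp in auto)
  then have "continuous_on ?G \<phi>"
    unfolding \<phi>_def case_prod_beta char_pt_grad_dir c_def by (intro continuous_intros)
  then have "path_connected (\<phi> ` ?G)" using pc by (rule path_connected_continuous_image)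
  moreover have "\<phi> ` ?G \<subseteq> T_set g S"
  proof
    fix x assume "x \<in> \<phi> ` ?G"
    then obtain s t where st: "s \<in> {0..1}" "a s \<le> t" "t \<le> b s" "x = (char_pt g (c s) t, t)"
      by (auto simp: filled_graph_def \<phi>_def)
    have "min_at g (c s) t"
      by (rule min_at_mono[OF b_min[OF st(1)]]) (use st a_pos[OF st(1)] in auto)
    then have "0 < t \<and> min_at g (c s) t \<and> (\<forall>\<tau>>t. \<not> strict_min_at g (c s) \<tau>)"
      using fibre_iff[OF g cM[OF st(1)], of t] st(2) by (simp add: a_def)
    then show "x \<in> T_set g S"
      unfolding st(4) T_set_iff[OF g S] using cS[of s] st(1) by auto
  qed
  moreover have "onset_pt g y0 \<in> \<phi> ` ?G"
    using ab[of 0] by (auto simp: onset_pt_def \<phi>_def a_def filled_graph_def c_def intro!: image_eqI[of _ _ "(0, a 0)"])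
  moreover have "onset_pt g w \<in> \<phi> ` ?G"
    using ab[of 1] by (auto simp: onset_pt_def \<phi>_def a_def filled_graph_def c_def intro!: image_eqI[of _ _ "(1, a 1)"])
  ultimately show ?thesis
    by (meson path_component_of_subset path_connected_component)
qed

text \<open>The part of the set over one point \<open>y\<close> is a segment or a ray starting at \<open>onset_pt g y\<close>.\<close>

lemma path_component_onset_pt:
  fixes g :: "real ^ 'n \<Rightarrow> real"
  assumes g: "C2 g" and S: "S \<subseteq> M_set g" and X: "X \<in> T_set g S"
  obtains y where "y \<in> S" "path_component (T_set g S) X (onset_pt g y)"
proof -
  obtain x t where xt: "X = (x, t)" by fastforce
  obtain y where y: "y \<in> S" "x = char_pt g y t" "0 < t" "min_at g y t" "\<forall>\<tau>>t. \<not> strict_min_at g y \<tau>"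
    using X T_set_iff[OF g S] xt by blast
  have M: "y \<in> M_set g" using S y by blast
  have t: "last_strict_time g y \<le> t" using fibre_iff[OF g M, of t] y by blast
  let ?f = "\<lambda>s. (char_pt g y s, s)"
  have "?f ` {last_strict_time g y..t} \<subseteq> T_set g S"
  proof
    fix Z assume "Z \<in> ?f ` {last_strict_time g y..t}"
    then obtain s where s: "last_strict_time g y \<le> s" "s \<le> t" "Z = ?f s" by auto
    have "min_at g y s" by (rule min_at_mono[OF y(4)]) (use s last_strict_time(1)[OF g M] in auto)
    then have "0 < s \<and> min_at g y s \<and> (\<forall>\<tau>>s. \<not> strict_min_at g y \<tau>)"
      using fibre_iff[OF g M, of s] s(1) by blast
    then show "Z \<in> T_set g S" unfolding s(3) T_set_iff[OF g S] using y(1) by blast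
  qed
  moreover have "path_connected (?f ` {last_strict_time g y..t})"
    unfolding char_pt_grad_dir
    by (intro path_connected_continuous_image continuous_intros) (simp flip: is_interval_path_connected_1)
  moreover have "X \<in> ?f ` {last_strict_time g y..t}" "onset_pt g y \<in> ?f ` {last_strict_time g y..t}"
    using t xt y(2) by (auto simp: onset_pt_def)
  ultimately have "path_component (T_set g S) X (onset_pt g y)"
    by (meson path_component_of_subset path_connected_component)
  with y(1) show thesis by (rule that)
qed

text \<open>The estimate on \<open>dist y0 y\<close> keeps the direction from \<open>y\<close> to \<open>w\<close> inside the cone of ascent.\<close>

lemma ascent_connects:
  fixes g :: "real ^ 'n \<Rightarrow> real" and y0 y w :: "real ^ 'n"
  assumes g: "C2 g" and S: "S \<subseteq> M_set g"
    and cone: "\<And>x x' s. \<lbrakk>x \<in> ball y0 r; x' \<in> ball y0 r; 0 < s; norm (x' - x - s *\<^sub>R grad_dir g y0) < r * s\<rbrakk>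
      \<Longrightarrow> g x < g x'"
    and \<delta>: "0 < \<delta>" and w: "w = y0 + \<delta> *\<^sub>R grad_dir g y0"
    and ball: "y \<in> ball y0 r" "w \<in> ball y0 r" and near: "dist y0 y < r * \<delta>"
    and E: "\<And>s. \<lbrakk>0 < s; s \<le> 1\<rbrakk> \<Longrightarrow> y + s *\<^sub>R (w - y) \<in> E_set g \<inter> S" and yS: "y \<in> S"
  shows "path_component (T_set g S) (onset_pt g y) (onset_pt g w)"
proof (rule segment_connects[OF g S])
  let ?c = "\<lambda>s. y + s *\<^sub>R (w - y)"
  have in_ball: "?c s \<in> ball y0 r" if "0 \<le> s" "s \<le> 1" for s
  proof -
    have "?c s \<in> closed_segment y w"
      using that by (auto simp: closed_segment_def algebra_simps intro!: exI[of _ s])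
    then show ?thesis using closed_segment_subset[OF ball convex_ball] by blast
  qed
  show "?c s \<in> E_set g" if "0 < s" "s \<le> 1" for s using E[OF that] by blast
  show "?c s \<in> S" if "0 \<le> s" "s \<le> 1" for s using E[of s] that yS by (cases "s = 0") auto
  show "g (?c p) < g (?c s)" if "0 \<le> p" "p < s" "s \<le> 1" for p s
  proof (rule cone[where s = "(s - p) * \<delta>"])
    show "?c p \<in> ball y0 r" by (rule in_ball) (use that in auto)
    show "?c s \<in> ball y0 r" by (rule in_ball) (use that in auto)
    show "0 < (s - p) * \<delta>" using that \<delta> by simp
    have "?c s - ?c p - ((s - p) * \<delta>) *\<^sub>R grad_dir g y0 = (s - p) *\<^sub>R (w - y - \<delta> *\<^sub>R grad_dir g y0)"
      by (simp add: algebra_simps)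
    also have "w - y - \<delta> *\<^sub>R grad_dir g y0 = y0 - y" by (simp add: w)
    finally have "norm (?c s - ?c p - ((s - p) * \<delta>) *\<^sub>R grad_dir g y0) = (s - p) * dist y0 y"
      using that by (simp add: dist_norm)
    also have "\<dots> < (s - p) * (r * \<delta>)" using near that by (intro mult_strict_left_mono) auto
    finally show "norm (?c s - ?c p - ((s - p) * \<delta>) *\<^sub>R grad_dir g y0) < r * ((s - p) * \<delta>)"
      by (simp add: mult_ac)
  qed
qed

text \<open>All points close to \<open>y0\<close> climb to the common point \<open>w\<close>, which lies above \<open>y0\<close> on the ray along the gradient.\<close>

lemma onset_connected_near:
  fixes g :: "real ^ 'n \<Rightarrow> real"
  assumes g: "C2 g" and S: "S \<subseteq> M_set g" and C: "open C" "C \<subseteq> E_set g \<inter> S" and y0: "y0 \<in> C"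
  obtains d where "0 < d" "\<And>y. y \<in> ball y0 d \<Longrightarrow> path_component (T_set g S) (onset_pt g y0) (onset_pt g y)"
proof -
  have p: "grad g y0 \<noteq> 0" using C y0 by (auto simp: E_set_def)
  obtain r where r: "0 < r" "\<And>x. x \<in> ball y0 r \<Longrightarrow> grad g x \<noteq> 0"
    "\<And>x x' s. \<lbrakk>x \<in> ball y0 r; x' \<in> ball y0 r; 0 < s; norm (x' - x - s *\<^sub>R grad_dir g y0) < r * s\<rbrakk> \<Longrightarrow> g x < g x'"
    by (rule ascent_cone[OF g p], rule that)
  obtain e where e: "0 < e" "ball y0 e \<subseteq> C" using C(1) y0 open_contains_ball by blast
  define \<delta> where "\<delta> = min r e / 2"
  have \<delta>: "0 < \<delta>" "\<delta> < r" "\<delta> < e" using r e by (auto simp: \<delta>_def)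
  define w where "w = y0 + \<delta> *\<^sub>R grad_dir g y0"
  have w: "dist y0 w = \<delta>" using \<delta> norm_grad_dir[OF p] by (simp add: w_def dist_norm)
  define d where "d = min (min r e) (r * \<delta>)"
  have up: "path_component (T_set g S) (onset_pt g y) (onset_pt g w)" if y: "y \<in> ball y0 d" for y
  proof (rule ascent_connects[OF g S r(3) \<delta>(1) w_def])
    show "y \<in> ball y0 r" "w \<in> ball y0 r" "dist y0 y < r * \<delta>"
      using y w \<delta> by (auto simp: d_def)
    have ye: "y \<in> ball y0 e" "w \<in> ball y0 e" using y w \<delta> by (auto simp: d_def)
    show "y + s *\<^sub>R (w - y) \<in> E_set g \<inter> S" if "0 < s" "s \<le> 1" for s
    proof -
      have "y + s *\<^sub>R (w - y) \<in> closed_segment y w"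
        using that by (auto simp: closed_segment_def algebra_simps intro!: exI[of _ s])
      then show ?thesis using closed_segment_subset[OF ye convex_ball] e(2) C(2) by blast
    qed
    show "y \<in> S" using ye e(2) C(2) by blast
  qed
  have d: "0 < d" using r e \<delta> by (simp add: d_def)
  then have "path_component (T_set g S) (onset_pt g y0) (onset_pt g w)" by (intro up) simp
  then have "path_component (T_set g S) (onset_pt g y0) (onset_pt g y)" if "y \<in> ball y0 d" for y
    using up[OF that] path_component_sym path_component_trans by blast
  with d show thesis by (rule that)
qed

text \<open>The ray from \<open>y0\<close> along the gradient immediately enters \<open>C\<close>: either \<open>y0\<close> is in the open set \<open>C\<close>, or the
side above \<open>y0\<close> is contained in \<open>C\<close> near \<open>y0\<close>.\<close>

lemma onset_connected_to_component:
  fixes g :: "real ^ 'n \<Rightarrow> real"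
  assumes g: "C2 g" and C: "C \<in> path_components_of (top_of_set (E_set g))" and y0: "y0 \<in> F_set g C"
  obtains w where "w \<in> C" "path_component (T_set g (F_set g C)) (onset_pt g y0) (onset_pt g w)"
proof -
  have S: "F_set g C \<subseteq> M_set g" by (rule F_set_subset_M[OF g C])
  have CE: "C \<subseteq> E_set g" using path_component_of_open(3)[OF open_E_set[OF g] C] .
  have p: "grad g y0 \<noteq> 0" using y0 S by (auto simp: M_set_def)
  obtain r where r: "0 < r" "\<And>x. x \<in> ball y0 r \<Longrightarrow> grad g x \<noteq> 0"
    "\<And>x x' s. \<lbrakk>x \<in> ball y0 r; x' \<in> ball y0 r; 0 < s; norm (x' - x - s *\<^sub>R grad_dir g y0) < r * s\<rbrakk> \<Longrightarrow> g x < g x'"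
    by (rule ascent_cone[OF g p], rule that)
  have "\<exists>W. open W \<and> y0 \<in> W \<and> W \<inter> {y. g y0 < g y} \<subseteq> C"
  proof (cases "y0 \<in> C")
    case True
    then show ?thesis using path_component_of_open(1)[OF open_E_set[OF g] C] by blast
  next
    case False
    then obtain N U where "separated_nbhd g y0 N" "open U" "y0 \<in> U" "U \<inter> H_plus g N y0 \<subseteq> C"
      using y0 by (auto simp: F_set_def)
    then show ?thesis
      by (intro exI[of _ "N \<inter> U"]) (auto simp: separated_nbhd_def H_plus_def)
  qed
  then obtain W where W: "open W" "y0 \<in> W" "W \<inter> {y. g y0 < g y} \<subseteq> C" by blast
  obtain e where e: "0 < e" "ball y0 e \<subseteq> W" using W open_contains_ball by blast
  define \<delta> where "\<delta> = min r e / 2"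
  have \<delta>: "0 < \<delta>" "\<delta> < r" "\<delta> < e" using r e by (auto simp: \<delta>_def)
  define w where "w = y0 + \<delta> *\<^sub>R grad_dir g y0"
  have on_ray: "y0 + s *\<^sub>R (w - y0) \<in> C" if s: "0 < s" "s \<le> 1" for s
  proof -
    have eq: "y0 + s *\<^sub>R (w - y0) = y0 + (s * \<delta>) *\<^sub>R grad_dir g y0" by (simp add: w_def)
    have d: "dist y0 (y0 + s *\<^sub>R (w - y0)) = s * \<delta>"
      unfolding eq using s \<delta> norm_grad_dir[OF p] by (simp add: dist_norm)
    have "s * \<delta> \<le> \<delta>" using s \<delta> by simp
    then have in_balls: "y0 + s *\<^sub>R (w - y0) \<in> ball y0 r" "y0 + s *\<^sub>R (w - y0) \<in> ball y0 e"
      unfolding mem_ball d using \<delta> by linarith+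
    have "g y0 < g (y0 + s *\<^sub>R (w - y0))"
      by (rule r(3)[where s = "s * \<delta>"]) (use in_balls s \<delta> r(1) eq in auto)
    then show ?thesis using W(3) e(2) in_balls(2) by blast
  qed
  have "path_component (T_set g (F_set g C)) (onset_pt g y0) (onset_pt g w)"
  proof (rule ascent_connects[OF g S r(3) \<delta>(1) w_def])
    show "y0 \<in> ball y0 r" "dist y0 y0 < r * \<delta>" "y0 \<in> F_set g C" using r \<delta> y0 by auto
    show "w \<in> ball y0 r" using \<delta> norm_grad_dir[OF p] by (simp add: w_def dist_norm)
    show "y0 + s *\<^sub>R (w - y0) \<in> E_set g \<inter> F_set g C" if "0 < s" "s \<le> 1" for s
      using on_ray[OF that] CE by (auto simp: F_set_def)
  qed
  moreover have "w \<in> C" using on_ray[of 1] by simp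
  ultimately show thesis by (intro that)
qed

proposition path_connected_T_set_F_set:
  fixes g :: "real ^ 'n \<Rightarrow> real"
  assumes g: "C2 g" and C: "C \<in> path_components_of (top_of_set (E_set g))"
  shows "path_connected (T_set g (F_set g C))"
proof -
  let ?T = "T_set g (F_set g C)"
  let ?R = "\<lambda>y w. path_component ?T (onset_pt g y) (onset_pt g w)"
  have S: "F_set g C \<subseteq> M_set g" by (rule F_set_subset_M[OF g C])
  note Cprops = path_component_of_open[OF open_E_set[OF g] C]
  have CF: "C \<subseteq> E_set g \<inter> F_set g C" using Cprops(3) by (auto simp: F_set_def)
  have in_C: "?R y w" if "y \<in> C" "w \<in> C" for y w
  proof (rule connected_equivalence_relation[where S = C and R = ?R, OF _ that])
    show "connected C" using Cprops(2) by (rule path_connected_imp_connected)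
    show "\<exists>W. openin (top_of_set C) W \<and> y0 \<in> W \<and> (\<forall>x\<in>W. ?R y0 x)" if y0: "y0 \<in> C" for y0
    proof -
      obtain d where d: "0 < d" "\<And>y. y \<in> ball y0 d \<Longrightarrow> ?R y0 y"
        using onset_connected_near[OF g S Cprops(1) CF y0] by blast
      then show ?thesis
        using y0 by (intro exI[of _ "C \<inter> ball y0 d"]) (auto simp: openin_open_Int)
    qed
  qed (auto intro: path_component_sym path_component_trans)
  show ?thesis
    unfolding path_connected_component
  proof (intro ballI)
    have to_C: "\<exists>w\<in>C. path_component ?T X (onset_pt g w)" if X: "X \<in> ?T" for X
    proof -
      obtain y where y: "y \<in> F_set g C" "path_component ?T X (onset_pt g y)"
        using path_component_onset_pt[OF g S X] .
      obtain w where "w \<in> C" "?R y w" using onset_connected_to_component[OF g C y(1)] .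
      with y(2) show ?thesis using path_component_trans by blast
    qed
    fix X Y assume X: "X \<in> ?T" and Y: "Y \<in> ?T"
    obtain w where w: "w \<in> C" "path_component ?T X (onset_pt g w)" using to_C[OF X] by blast
    obtain v where v: "v \<in> C" "path_component ?T Y (onset_pt g v)" using to_C[OF Y] by blast
    show "path_component ?T X Y"
      by (rule path_component_trans[OF w(2) path_component_trans[OF in_C[OF w(1) v(1)]
            path_component_sym[OF v(2)]]])
  qed
qed

theorem theorem4p9:
  fixes g :: "real ^ 'n \<Rightarrow> real"
  assumes "C2 g"
  shows "Sigma_set g \<union> T1_set g
           = (\<Union>C \<in> path_components_of (top_of_set (E_set g)). T_set g (F_set g C))
       \<and> Sigma_set g \<union> T1_set g
           = \<Union> (path_components_of (top_of_set (Sigma_set g \<union> T1_set g)))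
       \<and> countable (path_components_of (top_of_set (Sigma_set g \<union> T1_set g)))"
proof (intro conjI)
  let ?P = "path_components_of (top_of_set (E_set g))"
  show eq: "Sigma_set g \<union> T1_set g = (\<Union>C \<in> ?P. T_set g (F_set g C))"
    unfolding Sigma_Un_T1_eq[OF assms] M_eq_Union_F_set[OF assms] T_set_Union ..
  show "Sigma_set g \<union> T1_set g = \<Union> (path_components_of (top_of_set (Sigma_set g \<union> T1_set g)))"
    by (simp add: Union_path_components_of)
  show "countable (path_components_of (top_of_set (Sigma_set g \<union> T1_set g)))"
    by (rule countable_path_components_of_Union[OF countable_path_components_of_open[OF open_E_set[OF assms]]
          path_connected_T_set_F_set[OF assms] eq])
qed

end
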